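(* Let $B$ be a unital $C^*$-algebra and let $M\subset B$ be a unital norm-closed subspace. Let $\omega$ be a pure state on $B$. Then the following statements are equivalent. (i) The restriction $\omega|_M$ admits a unique state extension to $B$. (ii) The set $\{\Psi\in\mathcal{S}(\mathbb{M}_2(B)):\Psi|_{\mathcal{A}(M)}=\Phi_\omega|_{\mathcal{A}(M)}\}$ is an $(\mathcal{A}(M),\varepsilon)$-pinnacle set for every $\varepsilon>0$. (iii) The set $\{\Psi\in\mathcal{S}(\mathbb{M}_2(B)):\Psi|_{\mathcal{A}(M)}=\Phi_\omega|_{\mathcal{A}(M)}\}$ is an $(\mathcal{A}(M),\varepsilon)$-pinnacle set for some $\varepsilon>0$.
   Context: A unital subspace of a unital $C^*$-algebra is a complex linear subspace containing the unit. States are unital contractive linear functionals; pure states are extreme points of the set of states; $\mathcal{S}(C)$ is the state space of a unital $C^*$-algebra $C$ with the weak-$*$ topology. $\mathcal{A}(M)\subset\mathbb{M}_2(B)$ is the unital subalgebra of all elements $\begin{bmatrix}\lambda I& x\\0&\lambda I\end{bmatrix}$ with $\lambda\in\mathbb{C}$ and $x\in M$. For a state $\omega$ on $B$, $\Phi_\omega$ is the state on $\mathbb{M}_2(B)$ given by $\Phi_\omega([b_{ij}])=\frac12\big(\omega(b_{11})+\omega(b_{12})+\omega(b_{21})+\omega(b_{22})\big)$. Given a unital $C^*$-algebra $C$, a unital subspace $N\subset C$, a state $\theta$ on $C$ and $\varepsilon>0$, the set $E_\theta=\{\Psi\in\mathcal{S}(C):\Psi|_N=\theta|_N\}$ is an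 $(N,\varepsilon)$-pinnacle set if, given any compact subset $K\subset\mathcal{S}(C)\setminus\{\theta\}$, there is $x\in N$ with $\|x\|\le1+\varepsilon$ such that $\Omega(x^*x)>1>\psi(x^*x)$ for every $\Omega\in E_\theta$ and $\psi\in K$. In the statement this is applied with $C=\mathbb{M}_2(B)$, $N=\mathcal{A}(M)$ and $\theta=\Phi_\omega$. *)

theory Defs
  imports "HOL-Analysis.Analysis" "HOL-Library.Complex_Order"
begin

section \<open>Unital C*-algebras\<close>

class scaleC =
  fixes scaleC :: "complex \<Rightarrow> 'a \<Rightarrow> 'a"  (infixr "*\<^sub>C" 75)

class star =
  fixes star :: "'a \<Rightarrow> 'a"

class complex_star_algebra_1 = ring_1 + scaleC + star +
  assumes scaleC_add_right: "a *\<^sub>C (x + y) = a *\<^sub>C x + a *\<^sub>C y"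
    and scaleC_add_left: "(a + b) *\<^sub>C x = a *\<^sub>C x + b *\<^sub>C x"
    and scaleC_scaleC: "a *\<^sub>C (b *\<^sub>C x) = (a * b) *\<^sub>C x"
    and scaleC_one: "1 *\<^sub>C x = x"
    and mult_scaleC_left: "(a *\<^sub>C x) * y = a *\<^sub>C (x * y)"
    and mult_scaleC_right: "x * (a *\<^sub>C y) = a *\<^sub>C (x * y)"
    and star_star: "star (star x) = x"
    and star_add: "star (x + y) = star x + star y"
    and star_mult: "star (x * y) = star y * star x"
    and star_scaleC: "star (a *\<^sub>C x) = cnj a *\<^sub>C star x"

text \<open>
  The superclass \<^class>\<open>real_normed_algebra_1\<close> excludes the zero algebra, which has no states.
\<close>

class cstar_algebra_1 = complex_star_algebra_1 + real_normed_algebra_1 + banach +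
  assumes scaleR_scaleC: "r *\<^sub>R x = complex_of_real r *\<^sub>C x"
    and norm_scaleC: "norm (a *\<^sub>C x) = cmod a * norm x"
    and cstar_identity: "norm (star x * x) = (norm x)\<^sup>2"

section \<open>The C*-algebra of two-by-two matrices\<close>

datatype 'b mat2 = Mat2 (e11: 'b) (e12: 'b) (e21: 'b) (e22: 'b)

instantiation mat2 :: (complex_star_algebra_1) complex_star_algebra_1
begin

definition zero_mat2 :: "'a mat2" where
  "0 = Mat2 0 0 0 0"

definition one_mat2 :: "'a mat2" where
  "1 = Mat2 1 0 0 1"

definition plus_mat2 :: "'a mat2 \<Rightarrow> 'a mat2 \<Rightarrow> 'a mat2" where
  "A + B = Mat2 (e11 A + e11 B) (e12 A + e12 B) (e21 A + e21 B) (e22 A + e22 B)"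

definition minus_mat2 :: "'a mat2 \<Rightarrow> 'a mat2 \<Rightarrow> 'a mat2" where
  "A - B = Mat2 (e11 A - e11 B) (e12 A - e12 B) (e21 A - e21 B) (e22 A - e22 B)"

definition uminus_mat2 :: "'a mat2 \<Rightarrow> 'a mat2" where
  "- A = Mat2 (- e11 A) (- e12 A) (- e21 A) (- e22 A)"

definition times_mat2 :: "'a mat2 \<Rightarrow> 'a mat2 \<Rightarrow> 'a mat2" where
  "A * B = Mat2 (e11 A * e11 B + e12 A * e21 B) (e11 A * e12 B + e12 A * e22 B)
                (e21 A * e11 B + e22 A * e21 B) (e21 A * e12 B + e22 A * e22 B)"

definition scaleC_mat2 :: "complex \<Rightarrow> 'a mat2 \<Rightarrow> 'a mat2" where
  "a *\<^sub>C A = Mat2 (a *\<^sub>C e11 A) (a *\<^sub>C e12 A) (a *\<^sub>C e21 A) (a *\<^sub>C e22 A)"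

definition star_mat2 :: "'a mat2 \<Rightarrow> 'a mat2" where
  "star A = Mat2 (star (e11 A)) (star (e21 A)) (star (e12 A)) (star (e22 A))"

instance
  by standard
    (simp_all add: zero_mat2_def one_mat2_def plus_mat2_def minus_mat2_def uminus_mat2_def
      times_mat2_def scaleC_mat2_def star_mat2_def mat2.expand algebra_simps
      scaleC_add_right scaleC_add_left scaleC_scaleC scaleC_one mult_scaleC_left
      mult_scaleC_right star_star star_add star_mult star_scaleC)

end

text \<open>
  The C*-norm of a matrix over \<open>B\<close> is its operator norm on the Hilbert \<open>B\<close>-module of columns
  \<open>(u, v)\<close>, whose norm is the square root of the norm of \<open>u*u + v*v\<close>.
\<close>

definition column_norm :: "'b::cstar_algebra_1 \<Rightarrow> 'b \<Rightarrow> real" where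
  "column_norm u v = sqrt (norm (star u * u + star v * v))"

definition mat2_norm :: "'b::cstar_algebra_1 mat2 \<Rightarrow> real" where
  "mat2_norm A = (SUP (u, v) \<in> {(u, v). column_norm u v \<le> 1}.
                    column_norm (e11 A * u + e12 A * v) (e21 A * u + e22 A * v))"

section \<open>States and pinnacle sets\<close>

text \<open>
  The definitions below concern a unital C*-algebra whose norm is passed as the argument \<open>nrm\<close>:
  it is \<^const>\<open>norm\<close> for \<open>B\<close> itself and \<^const>\<open>mat2_norm\<close> for the two-by-two matrices over \<open>B\<close>.
\<close>

definition unital_subspace :: "'c::complex_star_algebra_1 set \<Rightarrow> bool" where
  "unital_subspace N \<longleftrightarrow> module.subspace scaleC N \<and> 1 \<in> N"

definition states :: "('c::complex_star_algebra_1 \<Rightarrow> real) \<Rightarrow> ('c \<Rightarrow> complex) set" where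
  "states nrm = {\<phi>. Vector_Spaces.linear scaleC (*) \<phi> \<and> \<phi> 1 = 1 \<and> (\<forall>x. cmod (\<phi> x) \<le> nrm x)}"

text \<open>Pure states are the extreme points of the convex set of states.\<close>

definition pure_state :: "('c::complex_star_algebra_1 \<Rightarrow> real) \<Rightarrow> ('c \<Rightarrow> complex) \<Rightarrow> bool" where
  "pure_state nrm \<omega> \<longleftrightarrow> \<omega> \<in> states nrm \<and>
     (\<forall>\<phi>\<in>states nrm. \<forall>\<psi>\<in>states nrm. \<forall>t::real. 0 < t \<and> t < 1 \<and>
        (\<forall>x. \<omega> x = of_real t * \<phi> x + of_real (1 - t) * \<psi> x) \<longrightarrow> \<phi> = \<omega> \<and> \<psi> = \<omega>)"

definition state_extensions ::
  "('c::complex_star_algebra_1 \<Rightarrow> real) \<Rightarrow> 'c set \<Rightarrow> ('c \<Rightarrow> complex) \<Rightarrow> ('c \<Rightarrow> complex) set" where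
  "state_extensions nrm N \<theta> = {\<Psi> \<in> states nrm. \<forall>x\<in>N. \<Psi> x = \<theta> x}"

text \<open>
  \<open>pinnacle_set nrm N \<epsilon> \<theta>\<close> says that \<open>state_extensions nrm N \<theta>\<close> is an \<open>(N, \<epsilon>)\<close>-pinnacle set. The
  topology on functions is that of pointwise convergence, which on states is the weak-*
  topology. The order on complex numbers is that of \<^theory>\<open>HOL-Library.Complex_Order\<close>, so that
  both inequalities include that the value of the state is real.
\<close>

definition pinnacle_set ::
  "('c::complex_star_algebra_1 \<Rightarrow> real) \<Rightarrow> 'c set \<Rightarrow> real \<Rightarrow> ('c \<Rightarrow> complex) \<Rightarrow> bool" where
  "pinnacle_set nrm N \<epsilon> \<theta> \<longleftrightarrow>
     (\<forall>K. compact K \<and> K \<subseteq> states nrm - {\<theta>} \<longrightarrow>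
        (\<exists>x\<in>N. nrm x \<le> 1 + \<epsilon> \<and>
           (\<forall>\<Omega>\<in>state_extensions nrm N \<theta>. \<Omega> (star x * x) > 1) \<and>
           (\<forall>\<psi>\<in>K. 1 > \<psi> (star x * x))))"

definition upper_algebra :: "'b::complex_star_algebra_1 set \<Rightarrow> 'b mat2 set" where
  "upper_algebra M = {Mat2 (c *\<^sub>C 1) x 0 (c *\<^sub>C 1) | c x. x \<in> M}"

definition matrix_state :: "('b \<Rightarrow> complex) \<Rightarrow> 'b mat2 \<Rightarrow> complex" where
  "matrix_state \<omega> A = (\<omega> (e11 A) + \<omega> (e12 A) + \<omega> (e21 A) + \<omega> (e22 A)) / 2"

end

theory Submission
  imports Defs
begin

text \<open>
  The heart of the matter is a statement about slices. Let \<open>\<theta>\<close> be a pure state, \<open>N\<close> a unital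
  subspace on which \<open>\<theta>\<close> has no other state extension, and \<open>K\<close> a compact set of states that misses
  \<open>\<theta>\<close>. A pure state has a neighbourhood base of slices, and because every state other than \<open>\<theta>\<close>
  differs from \<open>\<theta>\<close> somewhere on \<open>N\<close>, the slice can be cut out by an element of \<open>N\<close>: some
  \<open>a \<in> N\<close> satisfies \<open>Re \<theta>(a) > 0 > Re \<psi>(a)\<close> uniformly for \<open>\<psi> \<in> K\<close>
  (\<open>pure_state_slice\<close>). Now take \<open>x = 1 + \<delta>a\<close> with a small \<open>\<delta> > 0\<close>. Since
  \<open>x*x = 1 + \<delta>(a + a*) + \<delta>\<^sup>2 a*a\<close>, the first-order term decides on which side of \<open>1\<close> a state puts
  \<open>x*x\<close>, while the norm of \<open>x\<close> is at most \<open>1 + \<epsilon>\<close>. So \<open>x\<close> witnesses the pinnacle property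
  (\<open>pinnacle_set_pure_state\<close>). Conversely, a pinnacle set cannot contain a state \<open>\<Psi> \<noteq> \<theta>\<close>, because
  \<open>K = {\<Psi>}\<close> would require \<open>\<Psi>(x*x) > 1 > \<Psi>(x*x)\<close> (\<open>pinnacle_set_imp_unique\<close>).

  It remains to transport uniqueness and purity between \<open>\<omega>\<close> and \<open>\<Phi>\<^sub>\<omega>\<close>. Let \<open>q\<close> be the projection
  all of whose entries are \<open>1/2\<close>. The states of the form \<open>\<Phi>\<^sub>\<psi>\<close> are those with value \<open>1\<close> at \<open>q\<close>,
  as such a state only sees the corner \<open>q M\<^sub>2(B) q\<close>, which is a copy of \<open>B\<close>
  (\<open>mat2_state_eq_matrix_state\<close>). The upper triangular matrix unit lies in \<open>\<A>(M)\<close>, and a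
  state with value \<open>1/2\<close> there has value \<open>1\<close> at \<open>q\<close>. Hence the extensions of
  \<open>\<Phi>\<^sub>\<omega>\<close> from \<open>\<A>(M)\<close> are exactly the \<open>\<Phi>\<^sub>\<psi>\<close> with \<open>\<psi>\<close> an extension of \<open>\<omega>\<close> from \<open>M\<close>
  (\<open>state_extensions_upper_algebra\<close>); and as \<open>1\<close> is the largest value that a state takes at \<open>q\<close>,
  purity of \<open>\<omega>\<close> passes to \<open>\<Phi>\<^sub>\<omega>\<close> (\<open>pure_matrix_state\<close>).

  The second-order norm estimates on \<open>M\<^sub>2(B)\<close> in these arguments all have one form: an identity between
  sums of elements \<open>X*X\<close> gives an inequality between the squares of the norms
  (\<open>mat2_norm_sq_le\<close>). This needs the order structure of \<open>B\<close>, that is, that elements \<open>x*x\<close> are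
  positive and that the norm is monotone on the positive cone. That part is built up from square
  roots of positive elements.
\<close>

section \<open>Square roots and positive elements in a unital C*-algebra\<close>

lemma vector_space_scaleC:
  "vector_space (scaleC :: complex \<Rightarrow> 'c \<Rightarrow> 'c::complex_star_algebra_1)"
  by unfold_locales (simp_all add: scaleC_add_right scaleC_add_left scaleC_scaleC scaleC_one)

lemma vector_space_complex: "vector_space ((*) :: complex \<Rightarrow> complex \<Rightarrow> complex)"
  by unfold_locales (simp_all add: algebra_simps)

interpretation scaleC: vector_space "scaleC :: complex \<Rightarrow> 'c \<Rightarrow> 'c::complex_star_algebra_1"
  by (rule vector_space_scaleC)

lemma star_zero [simp]: "star (0::'a::complex_star_algebra_1) = 0"
  using star_add[of "0::'a" 0] by simp

lemma star_one [simp]: "star (1::'a::complex_star_algebra_1) = 1"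
  using star_mult[of "star (1::'a)" 1] by (simp add: star_star)

lemma star_minus: "star (- x::'a::complex_star_algebra_1) = - star x"
  using star_add[of x "- x"] by (simp add: minus_unique)

lemma star_diff: "star (x - y::'a::complex_star_algebra_1) = star x - star y"
  using star_add[of x "- y"] by (simp add: star_minus)

lemma star_power: "star (x ^ n::'a::complex_star_algebra_1) = star x ^ n"
  by (induction n) (simp_all add: star_mult power_commutes)

lemma star_scaleR: "star (r *\<^sub>R x::'a::cstar_algebra_1) = r *\<^sub>R star x"
  by (simp add: scaleR_scaleC star_scaleC)

lemma star_of_real [simp]: "star (of_real r::'a::cstar_algebra_1) = of_real r"
  by (simp add: of_real_def star_scaleR)

lemma norm_star [simp]: "norm (star x::'a::cstar_algebra_1) = norm x"
proof -
  have le: "norm y \<le> norm (star y)" for y :: 'a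
  proof (cases "y = 0")
    case False
    have "norm y * norm y = norm (star y * y)"
      by (simp add: cstar_identity power2_eq_square)
    also have "\<dots> \<le> norm (star y) * norm y"
      by (rule norm_mult_ineq)
    finally show ?thesis
      using False by simp
  qed simp
  show ?thesis
    using le[of x] le[of "star x"] by (simp add: star_star)
qed

lemma bounded_linear_star: "bounded_linear (star :: 'a \<Rightarrow> 'a::cstar_algebra_1)"
  by (rule bounded_linear_intro[where K = 1]) (simp_all add: star_add star_scaleR)

lemma norm_selfadjoint_square:
  "star x = x \<Longrightarrow> norm (x * x) = (norm x)\<^sup>2" for x :: "'a::cstar_algebra_1"
  using cstar_identity[of x] by simp

text \<open>The Taylor coefficients of \<open>sqrt (1 - z)\<close> at \<open>0\<close>.\<close>

definition sqrt_coeff :: "nat \<Rightarrow> real" where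
  "sqrt_coeff n = (- 1) ^ n * ((1/2) gchoose n)"

lemma gbinomial_Suc_ratio:
  "((a::real) gchoose Suc n) = (a - real n) / real (Suc n) * (a gchoose n)"
  using gbinomial_mult_1[of a n] by (simp add: field_simps)

lemma sqrt_coeff_Suc_nonpos: "sqrt_coeff (Suc n) \<le> 0"
proof (induction n)
  case 0
  then show ?case by (simp add: sqrt_coeff_def)
next
  case (Suc n)
  have "sqrt_coeff (Suc (Suc n)) = (real (Suc n) - 1/2) / real (Suc (Suc n)) * sqrt_coeff (Suc n)"
    unfolding sqrt_coeff_def gbinomial_Suc_ratio[of _ "Suc n"] power_Suc[of _ "Suc n"]
    by (simp add: field_simps)
  also have "\<dots> \<le> 0"
    using Suc by (intro mult_nonneg_nonpos divide_nonneg_nonneg) auto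
  finally show ?case .
qed

text \<open>
  All coefficients but the first are nonpositive, so that a lower bound for the partial sums bounds
  the sum of the absolute values. This gives absolute convergence on the closed unit disc, boundary
  included. The partial sums have the closed form \<open>(-1)\<^sup>n (-1/2 gchoose n)\<close>.
\<close>

lemma sum_sqrt_coeff_nonneg: "(\<Sum>k\<le>n. sqrt_coeff k) \<ge> 0"
proof -
  have "(- 1) ^ n * ((- 1/2 :: real) gchoose n) \<ge> 0" for n
  proof (induction n)
    case (Suc n)
    have "(- 1) ^ Suc n * ((- 1/2 :: real) gchoose Suc n)
        = (real n + 1/2) / real (Suc n) * ((- 1) ^ n * ((- 1/2 :: real) gchoose n))"
      unfolding gbinomial_Suc_ratio[of _ n] by (simp add: field_simps)
    also have "\<dots> \<ge> 0"
      using Suc by (intro mult_nonneg_nonneg[OF divide_nonneg_nonneg]) auto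
    finally show ?case .
  qed simp
  moreover have "(\<Sum>k\<le>n. sqrt_coeff k) = (- 1) ^ n * ((- 1/2 :: real) gchoose n)"
    using gbinomial_sum_lower_neg[of "1/2::real" n] by (simp add: sqrt_coeff_def mult.commute)
  ultimately show ?thesis by simp
qed

lemma sum_abs_sqrt_coeff_Suc_le: "(\<Sum>k<n. \<bar>sqrt_coeff (Suc k)\<bar>) \<le> 1"
proof -
  have "(\<Sum>k<n. \<bar>sqrt_coeff (Suc k)\<bar>) = - (\<Sum>k<n. sqrt_coeff (Suc k))"
    using sqrt_coeff_Suc_nonpos by (simp add: abs_of_nonpos sum_negf)
  also have "\<dots> = 1 - (\<Sum>k\<le>n. sqrt_coeff k)"
    by (simp add: sum.atMost_shift sqrt_coeff_def)
  finally show ?thesis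
    using sum_sqrt_coeff_nonneg[of n] by simp
qed

lemma summable_abs_sqrt_coeff: "summable (\<lambda>n. \<bar>sqrt_coeff n\<bar>)"
proof -
  have "summable (\<lambda>n. \<bar>sqrt_coeff (Suc n)\<bar>)"
    using sum_abs_sqrt_coeff_Suc_le by (intro summableI_nonneg_bounded[where x=1]) auto
  then show ?thesis
    by (rule summable_Suc_iff[THEN iffD1])
qed

text \<open>
  The square of the power series of \<open>sqrt (1 - z)\<close> is \<open>1 - z\<close>. On coefficients this is the
  Vandermonde identity with both parameters \<open>1/2\<close>.
\<close>

lemma sqrt_coeff_convolution:
  "(\<Sum>i\<le>n. sqrt_coeff i * sqrt_coeff (n - i)) = (if n = 0 then 1 else if n = 1 then - 1 else 0)"
proof -
  have "(\<Sum>i\<le>n. sqrt_coeff i * sqrt_coeff (n - i))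
      = (\<Sum>i\<le>n. (- 1) ^ n * (((1/2) gchoose i) * ((1/2) gchoose (n - i))))"
  proof (intro sum.cong refl)
    fix i
    assume "i \<in> {..n}"
    then have "(- 1 :: real) ^ n = (- 1) ^ i * (- 1) ^ (n - i)"
      by (simp flip: power_add)
    then show "sqrt_coeff i * sqrt_coeff (n - i)
        = (- 1) ^ n * (((1/2) gchoose i) * ((1/2) gchoose (n - i)))"
      by (simp add: sqrt_coeff_def)
  qed
  also have "\<dots> = (- 1) ^ n * (1 gchoose n)"
    using gbinomial_Vandermonde[of "1/2::real" "1/2" n]
    by (simp add: sum_distrib_left[symmetric] atLeast0AtMost)
  also have "\<dots> = (if n = 0 then 1 else if n = 1 then - 1 else 0)"
    using binomial_gbinomial[of 1 n, where 'a = real] by (auto simp: binomial_eq_0)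
  finally show ?thesis .
qed

text \<open>
  The binomial series of the square root, evaluated at \<open>x\<close>. As a limit of polynomials in \<open>x\<close> with
  real coefficients, its value is selfadjoint and commutes with whatever commutes with \<open>x\<close>. The
  bound on \<open>1 - s\<close> will say that \<open>s\<close> is itself positive.
\<close>

lemma sqrt_one_minus_selfadjoint:
  fixes x :: "'a::cstar_algebra_1"
  assumes "norm x \<le> 1" and "star x = x"
  obtains s where "star s = s" "s * s = 1 - x" "norm (1 - s) \<le> 1"
    "\<And>y. y * x = x * y \<Longrightarrow> y * s = s * y"
proof -
  define f where "f n = sqrt_coeff n *\<^sub>R x ^ n" for n
  define s where "s = suminf f"
  have norm_f: "norm (f n) \<le> \<bar>sqrt_coeff n\<bar>" for n
  proof -
    have "norm (x ^ n) \<le> 1"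
      using norm_power_ineq[of x n] power_le_one[of "norm x" n] assms(1) by simp
    then show ?thesis
      by (simp add: f_def mult_left_le)
  qed
  have summable_norm: "summable (\<lambda>n. norm (f n))"
    using norm_f by (intro summable_comparison_test'[OF summable_abs_sqrt_coeff, of 0]) auto
  then have summable_norm_Suc: "summable (\<lambda>n. norm (f (Suc n)))"
    by (rule summable_Suc_iff[THEN iffD2])
  have summable: "summable f"
    using summable_norm
    by (rule summable_norm_cancel)
  have "f sums s"
    using summable by (simp add: s_def summable_sums)
  have "star s = s"
  proof -
    have "(\<lambda>n. star (f n)) sums star s"
      using bounded_linear.sums[OF bounded_linear_star \<open>f sums s\<close>] .
    moreover have "(\<lambda>n. star (f n)) = f"
      by (simp add: f_def[abs_def] star_scaleR star_power assms(2))
    ultimately show ?thesis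
      using \<open>f sums s\<close> sums_unique2 by metis
  qed
  moreover have "s * s = 1 - x"
  proof -
    have "(\<lambda>n. \<Sum>i\<le>n. f i * f (n - i)) sums (s * s)"
      unfolding s_def by (rule Cauchy_product_sums[OF summable_norm summable_norm])
    moreover have "(\<Sum>i\<le>n. f i * f (n - i)) = (if n = 0 then 1 else if n = 1 then - x else 0)" for n
    proof -
      have "(\<Sum>i\<le>n. f i * f (n - i)) = (\<Sum>i\<le>n. sqrt_coeff i * sqrt_coeff (n - i)) *\<^sub>R x ^ n"
        by (auto simp: f_def scaleR_sum_left simp flip: power_add intro!: sum.cong)
      then show ?thesis
        by (simp add: sqrt_coeff_convolution)
    qed
    moreover have "(\<lambda>n. if n = 0 then 1 else if n = 1 then - x else 0)
        sums (\<Sum>n\<in>{0, 1::nat}. if n = 0 then 1 else if n = 1 then - x else 0)"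
      by (rule sums_finite) auto
    ultimately show ?thesis
      using sums_unique2 by fastforce
  qed
  moreover have "norm (1 - s) \<le> 1"
  proof -
    have "s = 1 + (\<Sum>n. f (Suc n))"
      using suminf_split_head[OF summable] by (simp add: s_def f_def sqrt_coeff_def)
    then have "norm (1 - s) = norm (\<Sum>n. f (Suc n))"
      by simp
    also have "\<dots> \<le> (\<Sum>n. norm (f (Suc n)))"
      by (rule Series.summable_norm[OF summable_norm_Suc])
    also have "\<dots> \<le> 1"
    proof (rule suminf_le_const[OF summable_norm_Suc])
      fix n
      have "(\<Sum>i<n. norm (f (Suc i))) \<le> (\<Sum>i<n. \<bar>sqrt_coeff (Suc i)\<bar>)"
        by (intro sum_mono norm_f)
      then show "(\<Sum>i<n. norm (f (Suc i))) \<le> 1"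
        using sum_abs_sqrt_coeff_Suc_le[of n] by linarith
    qed
    finally show ?thesis .
  qed
  moreover have "y * s = s * y" if "y * x = x * y" for y
  proof -
    have "y * f n = f n * y" for n
      using power_commuting_commutes[OF that[symmetric], of n] by (simp add: f_def)
    then show ?thesis
      using sums_unique2[OF sums_mult[OF \<open>f sums s\<close>, of y]] sums_mult2[OF \<open>f sums s\<close>, of y]
      by presburger
  qed
  ultimately show ?thesis
    using that by blast
qed

text \<open>
  For a selfadjoint \<open>h\<close> the norm condition says that the spectrum of \<open>h\<close> lies in \<open>[0, 2t]\<close>. This
  form of positivity makes closure under sums immediate and is exactly what the binomial series for
  the square root needs.
\<close>

definition positive_element :: "'a::cstar_algebra_1 \<Rightarrow> bool" where
  "positive_element h \<longleftrightarrow> star h = h \<and> (\<exists>t. norm (of_real t - h) \<le> t)"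

lemma positive_selfadjoint: "positive_element h \<Longrightarrow> star h = h"
  by (simp add: positive_element_def)

lemma positive_zero [simp]: "positive_element 0"
  by (auto simp: positive_element_def intro: exI[of _ 0])

lemma positive_one [simp]: "positive_element 1"
  by (auto simp: positive_element_def intro: exI[of _ 1])

lemma positive_add:
  assumes "positive_element a" and "positive_element b"
  shows "positive_element (a + b)"
proof -
  obtain s t where "norm (of_real s - a) \<le> s" "norm (of_real t - b) \<le> t"
    using assms by (auto simp: positive_element_def)
  moreover have "of_real (s + t) - (a + b) = (of_real s - a) + (of_real t - b)"
    by simp
  ultimately have "norm (of_real (s + t) - (a + b)) \<le> s + t"
    using norm_triangle_ineq[of "of_real s - a" "of_real t - b"] by (simp only:)
  then show ?thesis
    using assms unfolding positive_element_def by (metis star_add)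
qed

lemma positive_scaleR:
  assumes "positive_element a" and "0 \<le> r"
  shows "positive_element (r *\<^sub>R a)"
proof -
  obtain t where t: "norm (of_real t - a) \<le> t"
    using assms by (auto simp: positive_element_def)
  have "of_real (r * t) - r *\<^sub>R a = r *\<^sub>R (of_real t - a)"
    by (simp add: scaleR_conv_of_real algebra_simps)
  then have "norm (of_real (r * t) - r *\<^sub>R a) \<le> r * t"
    using t assms(2) by (simp add: mult_left_mono)
  then show ?thesis
    using assms(1) unfolding positive_element_def by (metis star_scaleR)
qed

lemma positive_norm_minus_selfadjoint:
  assumes "star h = h" and "norm h \<le> t"
  shows "positive_element (of_real t - h)"
  using assms by (auto simp: positive_element_def star_diff intro: exI[of _ t])

lemma positive_sqrt:
  assumes "positive_element h"
  obtains s where "positive_element s" "s * s = h" "\<And>y. y * h = h * y \<Longrightarrow> y * s = s * y"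
proof -
  obtain t where t: "norm (of_real t - h) \<le> t"
    using assms by (auto simp: positive_element_def)
  show ?thesis
  proof (cases "t > 0")
    case False
    then have "t = 0"
      using t norm_ge_zero[of "of_real t - h"] by linarith
    then have "h = 0"
      using t by simp
    then show ?thesis
      using that[of 0] by simp
  next
    case True
    define x where "x = 1 - (1 / t) *\<^sub>R h"
    have "x = (1 / t) *\<^sub>R (of_real t - h)"
      using True by (simp add: x_def of_real_def algebra_simps)
    then have "norm x \<le> 1"
      using t True by simp
    moreover have "star x = x"
      using assms by (simp add: x_def star_diff star_scaleR positive_selfadjoint)
    ultimately obtain r where r: "star r = r" "r * r = 1 - x" "norm (1 - r) \<le> 1"
      "\<And>y. y * x = x * y \<Longrightarrow> y * r = r * y"
      by (rule sqrt_one_minus_selfadjoint) blast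
    have "positive_element r"
      using r(1,3) by (auto simp: positive_element_def intro: exI[of _ 1])
    then have "positive_element (sqrt t *\<^sub>R r)"
      using True by (simp add: positive_scaleR)
    moreover have "(sqrt t *\<^sub>R r) * (sqrt t *\<^sub>R r) = h"
      using True r(2) by (simp add: x_def)
    moreover have "y * (sqrt t *\<^sub>R r) = (sqrt t *\<^sub>R r) * y" if "y * h = h * y" for y
      using r(4)[of y] that by (simp add: x_def algebra_simps)
    ultimately show ?thesis
      using that by blast
  qed
qed

text \<open>
  If commuting selfadjoint \<open>k\<close> and \<open>m\<close> satisfy \<open>k\<^sup>2 + m\<^sup>2 = t\<^sup>2\<close>, then \<open>k + im\<close> is \<open>t\<close> times a
  unitary, and \<open>k\<close> is its real part. This replaces the use of the spectral radius formula.
\<close>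

lemma norm_le_of_sum_squares:
  fixes k m :: "'a::cstar_algebra_1"
  assumes "star k = k" "star m = m" "k * m = m * k" "k * k + m * m = of_real (t\<^sup>2)" "0 \<le> t"
  shows "norm k \<le> t"
proof -
  define w where "w = k + \<i> *\<^sub>C m"
  have star_w: "star w = k + (- \<i>) *\<^sub>C m"
    using assms by (simp add: w_def star_add star_scaleC)
  have "star w * w = k * k + m * m"
    unfolding star_w
    by (simp add: w_def algebra_simps mult_scaleC_left mult_scaleC_right scaleC_scaleC
        scaleC_one scaleC.scale_minus_left scaleC_add_right scaleC.scale_right_diff_distrib assms(3))
  then have "(norm w)\<^sup>2 = norm (of_real (t\<^sup>2) :: 'a)"
    using cstar_identity[of w] assms(4) by (simp only:)
  then have "(norm w)\<^sup>2 = t\<^sup>2"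
    by (simp only: norm_of_real abs_power2)
  then have "norm w = t"
    using assms(5) by simp
  have "2 *\<^sub>R k = w + star w"
    unfolding star_w by (simp add: w_def scaleR_2 scaleC.scale_minus_left)
  then have "2 * norm k \<le> norm w + norm (star w)"
    using norm_triangle_ineq[of w "star w"] by (metis norm_scaleR abs_numeral)
  then show ?thesis
    using \<open>norm w = t\<close> by simp
qed

text \<open>
  With \<open>t\<close> the norm of \<open>k\<close>, the element \<open>t\<^sup>2 - k\<^sup>2\<close> has a square root \<open>m\<close> that commutes with \<open>k\<close>,
  and the preceding lemma bounds it by \<open>t\<close>. Thus \<open>t\<^sup>2 - k\<^sup>2 = m\<^sup>2\<close> has norm at most \<open>t\<^sup>2\<close>.
\<close>

lemma positive_square:
  fixes k :: "'a::cstar_algebra_1"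
  assumes "star k = k"
  shows "positive_element (k * k)"
proof -
  define t where "t = norm k"
  have "norm (k * k) \<le> t\<^sup>2"
    using assms by (simp add: t_def norm_selfadjoint_square)
  moreover have "star (k * k) = k * k"
    using assms by (simp add: star_mult)
  ultimately have "positive_element (of_real (t\<^sup>2) - k * k)"
    by (intro positive_norm_minus_selfadjoint)
  then obtain m where m: "positive_element m" "m * m = of_real (t\<^sup>2) - k * k"
    "\<And>y. y * (of_real (t\<^sup>2) - k * k) = (of_real (t\<^sup>2) - k * k) * y \<Longrightarrow> y * m = m * y"
    using positive_sqrt by blast
  have km: "k * m = m * k"
    by (rule m(3)) (simp add: algebra_simps scaleR_conv_of_real[symmetric] of_real_def)
  have "norm m \<le> t"
    using km m(2) assms by (intro norm_le_of_sum_squares[of m k])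
      (auto simp: positive_selfadjoint[OF m(1)] t_def)
  then have "norm (of_real (t\<^sup>2) - k * k) \<le> t\<^sup>2"
    using norm_selfadjoint_square[OF positive_selfadjoint[OF m(1)]] m(2)
    by (simp add: power_mono)
  then show ?thesis
    using assms unfolding positive_element_def by (metis star_mult)
qed

lemma positive_mult_commuting:
  assumes "positive_element a" and "positive_element b" and "a * b = b * a"
  shows "positive_element (a * b)"
proof -
  obtain s where s: "positive_element s" "s * s = a" "\<And>y. y * a = a * y \<Longrightarrow> y * s = s * y"
    using positive_sqrt[OF assms(1)] by blast
  obtain r where r: "positive_element r" "r * r = b" "\<And>y. y * b = b * y \<Longrightarrow> y * r = r * y"
    using positive_sqrt[OF assms(2)] by blast
  have "s * b = b * s"
    using s(3)[of b] assms(3) by simp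
  then have sr: "s * r = r * s"
    by (rule r(3))
  have "(s * r) * (s * r) = (s * s) * (r * r)"
    using sr by (metis mult.assoc)
  moreover have "star (s * r) = s * r"
    using sr by (simp add: star_mult positive_selfadjoint s(1) r(1))
  ultimately show ?thesis
    using positive_square[of "s * r"] s(2) r(2) by simp
qed

text \<open>
  From \<open>-t \<le> k \<le> t\<close> it follows that \<open>t\<^sup>2 - k\<^sup>2 = (t - k)(t + k)\<close> is positive. Its square root
  completes \<open>k\<close> to \<open>t\<close> times a unitary.
\<close>

lemma norm_le_of_positive:
  fixes k :: "'a::cstar_algebra_1"
  assumes "positive_element (of_real t - k)" and "positive_element (of_real t + k)"
  shows "norm k \<le> t"
proof -
  have "(of_real t - k) + (of_real t + k) = of_real (t + t)"
    by (subst of_real_add) simp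
  then have sum: "positive_element (of_real (t + t) :: 'a)"
    using positive_add[OF assms] by (simp only:)
  have "0 \<le> t"
  proof -
    obtain s where "norm (of_real s - of_real (t + t) :: 'a) \<le> s"
      using sum by (auto simp: positive_element_def)
    then have "\<bar>s - (t + t)\<bar> \<le> s"
      by (metis norm_of_real of_real_diff)
    then show ?thesis
      by linarith
  qed
  have star_k: "star k = k"
    using positive_selfadjoint[OF assms(2)] by (simp add: star_add)
  have comm: "(of_real t - k) * (of_real t + k) = of_real (t\<^sup>2) - k * k"
    "(of_real t + k) * (of_real t - k) = of_real (t\<^sup>2) - k * k"
    by (simp_all add: algebra_simps of_real_def power2_eq_square)
  then have "positive_element (of_real (t\<^sup>2) - k * k)"
    using positive_mult_commuting[OF assms] by simp
  then obtain m where m: "positive_element m" "m * m = of_real (t\<^sup>2) - k * k"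
    "\<And>y. y * (of_real (t\<^sup>2) - k * k) = (of_real (t\<^sup>2) - k * k) * y \<Longrightarrow> y * m = m * y"
    using positive_sqrt by blast
  have "k * m = m * k"
    by (rule m(3)) (simp add: algebra_simps of_real_def)
  then show ?thesis
    using m(2) star_k \<open>0 \<le> t\<close>
    by (intro norm_le_of_sum_squares[of k m]) (auto simp: positive_selfadjoint[OF m(1)])
qed

lemma norm_mono_positive:
  fixes a b :: "'a::cstar_algebra_1"
  assumes "positive_element a" and "positive_element (b - a)"
  shows "norm a \<le> norm b"
proof (rule norm_le_of_positive)
  have "star b = b"
    using positive_selfadjoint[OF positive_add[OF assms]] by simp
  then have "positive_element (of_real (norm b) - b)"
    by (rule positive_norm_minus_selfadjoint) (rule order_refl)
  from positive_add[OF this assms(2)] show "positive_element (of_real (norm b) - a)"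
    by simp
  have "positive_element (of_real (norm b) :: 'a)"
    using positive_scaleR[OF positive_one, of "norm b"] by (simp add: of_real_def)
  from positive_add[OF this assms(1)] show "positive_element (of_real (norm b) + a)" .
qed

text \<open>
  Bernoulli's inequality \<open>(1 + d)\<^sup>n \<ge> 1 + nd\<close> for a positive element; the usual induction works,
  because everything in sight commutes with \<open>d\<close>.
\<close>

lemma bernoulli_positive:
  assumes "positive_element d"
  shows "positive_element ((1 + d) ^ n - 1 - real n *\<^sub>R d)"
proof (induction n)
  case (Suc n)
  define P where "P = (1 + d) ^ n"
  let ?q = "P - 1 - real n *\<^sub>R d"
  have "P * d = d * P"
    unfolding P_def by (rule power_commuting_commutes) (simp add: algebra_simps)
  then have "(1 + d) * ?q = ?q * (1 + d)"
    by (simp add: algebra_simps)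
  then have "positive_element ((1 + d) * ?q)"
    using Suc assms unfolding P_def by (intro positive_mult_commuting positive_add) simp_all
  moreover have "positive_element (real n *\<^sub>R (d * d))"
    using assms by (intro positive_scaleR positive_square) (simp_all add: positive_selfadjoint)
  moreover have "(1 + d) ^ Suc n - 1 - real (Suc n) *\<^sub>R d = (1 + d) * ?q + real n *\<^sub>R (d * d)"
    by (simp add: P_def[symmetric] algebra_simps)
  ultimately show ?case
    using positive_add by metis
qed simp

text \<open>
  In terms of spectra, \<open>y*y\<close> and \<open>yy*\<close> agree away from \<open>0\<close>, so one of them cannot be negative and
  the other one positive. The proof below avoids spectra: with \<open>d = -y*y\<close> and \<open>e = yy*\<close>, moving
  \<open>y*\<close> past powers gives \<open>d(1 + d)\<^sup>n = -y*(1 - e)\<^sup>n y\<close>, which is bounded in \<open>n\<close> since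
  \<open>0 \<le> e \<le> 1\<close>, whereas by Bernoulli's inequality it dominates \<open>nd\<^sup>2\<close>.
\<close>

lemma negative_star_mult_contraction_eq_zero:
  fixes y :: "'a::cstar_algebra_1"
  assumes "positive_element (- (star y * y))" and "positive_element (y * star y)" and "norm y \<le> 1"
  shows "y = 0"
proof -
  define d where "d = - (star y * y)"
  define e where "e = y * star y"
  have "norm (1 - e) \<le> 1"
  proof -
    have "norm e \<le> 1"
      using assms(3) norm_mult_ineq[of y "star y"] mult_le_one[of "norm y" "norm y"]
      by (simp add: e_def)
    then have "positive_element (of_real 1 - e)"
      using assms(2) by (intro positive_norm_minus_selfadjoint) (simp_all add: e_def star_mult star_star)
    then have "positive_element (of_real 1 + (1 - e))"
      using positive_add[OF positive_one] by simp
    then show ?thesis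
      using assms(2) by (intro norm_le_of_positive) (simp_all add: e_def)
  qed
  have intertwine: "star y * (1 - e) ^ n = (1 + d) ^ n * star y" for n
  proof (induction n)
    case (Suc n)
    have "star y * (1 - e) = (1 + d) * star y"
      by (simp add: d_def e_def algebra_simps)
    have "star y * (1 - e) ^ Suc n = (1 + d) * (star y * (1 - e) ^ n)"
      using \<open>star y * (1 - e) = (1 + d) * star y\<close> by (simp flip: mult.assoc)
    then show ?case
      using Suc by (simp add: mult.assoc)
  qed simp
  have bound: "real n * norm (d * d) \<le> 1" for n
  proof -
    let ?b = "(1 + d) ^ n * d"
    have pos_d: "positive_element d"
      using assms(1) by (simp add: d_def)
    have comm: "(1 + d) ^ n * d = d * (1 + d) ^ n"
      by (rule power_commuting_commutes) (simp add: algebra_simps)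
    have "positive_element (((1 + d) ^ n - 1 - real n *\<^sub>R d) * d)"
      by (rule positive_mult_commuting[OF bernoulli_positive[OF pos_d] pos_d])
         (simp add: algebra_simps comm)
    then have "positive_element (((1 + d) ^ n - 1 - real n *\<^sub>R d) * d + d)"
      using pos_d by (rule positive_add)
    then have "positive_element (?b - real n *\<^sub>R (d * d))"
      by (simp add: algebra_simps)
    then have "norm (real n *\<^sub>R (d * d)) \<le> norm ?b"
      by (rule norm_mono_positive[rotated])
         (intro positive_scaleR positive_square, auto simp: positive_selfadjoint[OF pos_d])
    also have "?b = - (star y * (1 - e) ^ n * y)"
      unfolding intertwine by (simp add: d_def mult.assoc)
    also have "norm \<dots> \<le> norm y * norm (1 - e) ^ n * norm y"
    proof -
      have "norm (star y * (1 - e) ^ n * y) \<le> norm (star y * (1 - e) ^ n) * norm y"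
        by (rule norm_mult_ineq)
      also have "\<dots> \<le> norm (star y) * norm ((1 - e) ^ n) * norm y"
        by (intro mult_right_mono norm_mult_ineq) simp
      also have "\<dots> \<le> norm y * norm (1 - e) ^ n * norm y"
        by (simp add: mult_left_mono mult_right_mono norm_power_ineq)
      finally show ?thesis by simp
    qed
    also have "\<dots> \<le> 1 * 1 * 1"
      using assms(3) \<open>norm (1 - e) \<le> 1\<close> by (intro mult_mono power_le_one) auto
    finally show ?thesis by simp
  qed
  have "norm (d * d) = 0"
  proof (rule ccontr)
    assume "norm (d * d) \<noteq> 0"
    then have "0 < norm (d * d)"
      by simp
    then show False
      using reals_Archimedean3[of "norm (d * d)"] bound by (meson not_less)
  qed
  then have "d = 0"
    using norm_selfadjoint_square[of d] assms(1) by (simp add: d_def star_mult star_star star_minus)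
  then show ?thesis
    using cstar_identity[of y] by (simp add: d_def)
qed

text \<open>
  If \<open>y*y \<le> 0\<close>, then \<open>yy* \<ge> 0\<close>, because \<open>y*y + yy*\<close> is half the sum of the squares of the
  selfadjoint elements \<open>y + y*\<close> and \<open>i(y - y*)\<close>. Scaling reduces the claim to contractions.
\<close>

lemma negative_star_mult_eq_zero:
  fixes y :: "'a::cstar_algebra_1"
  assumes "positive_element (- (star y * y))"
  shows "y = 0"
proof -
  define k m where "k = y + star y" and "m = \<i> *\<^sub>C (y - star y)"
  have "star k = k" "star m = m"
    by (simp_all add: k_def m_def star_add star_scaleC star_diff star_star
        scaleC.scale_right_diff_distrib)
  have mm: "m * m = - ((y - star y) * (y - star y))"
    by (simp add: m_def mult_scaleC_left mult_scaleC_right scaleC_scaleC scaleC.scale_minus_left scaleC_one)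
  have "k * k + m * m = 2 *\<^sub>R (y * star y + star y * y)"
    unfolding mm k_def by (simp add: algebra_simps scaleR_2)
  then have "y * star y = (1/2) *\<^sub>R (k * k + m * m) + - (star y * y)"
    by simp
  moreover have "positive_element ((1/2) *\<^sub>R (k * k + m * m))"
    using \<open>star k = k\<close> \<open>star m = m\<close> by (intro positive_scaleR positive_add positive_square) simp_all
  ultimately have pos: "positive_element (y * star y)"
    using assms positive_add by metis
  define r where "r = 1 / (norm y + 1)"
  have "0 < r"
    by (simp add: r_def add_nonneg_pos)
  have "r *\<^sub>R y = 0"
  proof (rule negative_star_mult_contraction_eq_zero)
    show "positive_element (- (star (r *\<^sub>R y) * (r *\<^sub>R y)))"
      using positive_scaleR[OF assms, of "r\<^sup>2"] by (simp add: star_scaleR power2_eq_square)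
    show "positive_element ((r *\<^sub>R y) * star (r *\<^sub>R y))"
      using positive_scaleR[OF pos, of "r\<^sup>2"] by (simp add: star_scaleR power2_eq_square)
    show "norm (r *\<^sub>R y) \<le> 1"
      by (simp add: r_def divide_le_eq add_nonneg_pos)
  qed
  then show ?thesis
    using \<open>0 < r\<close> by simp
qed

text \<open>
  The argument of Kelley and Vaught. Let \<open>a = |h|\<close> be the square root of \<open>h\<^sup>2\<close> for \<open>h = x*x\<close>. Then
  \<open>n = a - h\<close> is twice the negative part of \<open>h\<close>, and \<open>y = xn\<close> satisfies \<open>y*y = nhn = -nan \<le> 0\<close>.
  By the preceding lemma \<open>y = 0\<close>, which forces \<open>n = 0\<close>, that is, \<open>h = a \<ge> 0\<close>.
\<close>

theorem positive_star_mult: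
  fixes x :: "'a::cstar_algebra_1"
  shows "positive_element (star x * x)"
proof -
  define h where "h = star x * x"
  have star_h: "star h = h"
    by (simp add: h_def star_mult star_star)
  obtain a where a: "positive_element a" "a * a = h * h"
    "\<And>y. y * (h * h) = h * h * y \<Longrightarrow> y * a = a * y"
    using positive_sqrt[OF positive_square[OF star_h]] by blast
  obtain m where m: "positive_element m" "m * m = a" "\<And>y. y * a = a * y \<Longrightarrow> y * m = m * y"
    using positive_sqrt[OF a(1)] by blast
  have ha: "h * a = a * h"
    by (rule a(3)) (simp add: mult.assoc)
  define n where "n = a - h"
  have star_n: "star n = n"
    by (simp add: n_def star_diff star_h positive_selfadjoint[OF a(1)])
  have hn: "h * n = - (n * n) + a * n"
    by (simp add: n_def algebra_simps)
  have nn: "n * n = 2 *\<^sub>R (a * n)" "a * n = n * a"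
    using a(2) ha by (simp_all add: n_def algebra_simps scaleR_2)
  have pos: "positive_element (n * a * n)"
  proof -
    \<comment> \<open>The element \<open>nan\<close> is the square of the selfadjoint \<open>nm\<close> with \<open>m\<^sup>2 = a\<close>, so its positivity
      does not presuppose that \<open>n\<close> is positive.\<close>
    have nm: "n * m = m * n"
      by (rule m(3)) (simp add: nn)
    have "(n * m) * (n * m) = n * (m * m) * n"
      using nm by (metis mult.assoc)
    moreover have "star (n * m) = n * m"
      using nm by (simp add: star_mult star_n positive_selfadjoint[OF m(1)])
    ultimately show ?thesis
      using positive_square[of "n * m"] m(2) by simp
  qed
  define y where "y = x * n"
  have yy: "- (star y * y) = n * a * n"
  proof -
    have "star y * y = n * (h * n)"
      by (simp add: y_def star_mult star_n h_def mult.assoc)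
    also have "h * n = - (a * n)"
      by (simp add: hn nn(1) scaleR_2)
    finally show ?thesis
      by (simp add: mult.assoc)
  qed
  have "y = 0"
    using pos yy by (intro negative_star_mult_eq_zero) simp
  then have "n * a * n = 0"
    using yy by simp
  then have "(n * n) * (n * n) = 0"
    using nn by (simp add: mult.assoc) (metis mult.assoc mult_zero_left mult_zero_right scaleR_zero_right)
  then have "n = 0"
    using norm_selfadjoint_square[of "n * n"] norm_selfadjoint_square[OF star_n]
    by (simp add: star_mult star_n)
  then show ?thesis
    using a(1) by (simp add: n_def h_def)
qed

theorem norm_star_mult_le_sum:
  fixes x y :: "'a::cstar_algebra_1"
  shows "(norm x)\<^sup>2 \<le> norm (star x * x + star y * y)"
  using norm_mono_positive[of "star x * x" "star x * x + star y * y"]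
    positive_star_mult[of x] positive_star_mult[of y]
  by (simp add: cstar_identity)

section \<open>Columns and two-by-two matrices\<close>

text \<open>
  Columns over \<open>B\<close> form a Hilbert module with this \<open>B\<close>-valued inner product. The square of the
  column norm is the norm of the inner product of a column with itself.
\<close>

definition column_inner :: "'b::complex_star_algebra_1 \<times> 'b \<Rightarrow> 'b \<times> 'b \<Rightarrow> 'b" where
  "column_inner \<xi> \<eta> = star (fst \<xi>) * fst \<eta> + star (snd \<xi>) * snd \<eta>"

definition mat2_apply :: "'b::complex_star_algebra_1 mat2 \<Rightarrow> 'b \<times> 'b \<Rightarrow> 'b \<times> 'b" where
  "mat2_apply A \<xi> = (e11 A * fst \<xi> + e12 A * snd \<xi>, e21 A * fst \<xi> + e22 A * snd \<xi>)"

lemmas mat2_ops = zero_mat2_def one_mat2_def plus_mat2_def minus_mat2_def uminus_mat2_def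
  times_mat2_def scaleC_mat2_def star_mat2_def

lemma column_inner_add_right: "column_inner \<xi> (\<eta> + \<zeta>) = column_inner \<xi> \<eta> + column_inner \<xi> \<zeta>"
  by (simp add: column_inner_def algebra_simps)

lemma column_inner_mat2_apply:
  "column_inner (mat2_apply A \<xi>) \<eta> = column_inner \<xi> (mat2_apply (star A) \<eta>)"
  by (simp add: column_inner_def mat2_apply_def mat2_ops star_add star_mult algebra_simps)

lemma mat2_apply_mult: "mat2_apply (A * B) \<xi> = mat2_apply A (mat2_apply B \<xi>)"
  by (simp add: mat2_apply_def mat2_ops algebra_simps)

lemma mat2_apply_add: "mat2_apply (A + B) \<xi> = mat2_apply A \<xi> + mat2_apply B \<xi>"
  by (simp add: mat2_apply_def mat2_ops algebra_simps)

lemma positive_column_inner: "positive_element (column_inner \<xi> \<xi>)"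
  by (simp add: column_inner_def positive_add positive_star_mult)

lemma column_norm_sq: "(column_norm u v)\<^sup>2 = norm (column_inner (u, v) (u, v))"
  by (simp add: column_norm_def column_inner_def)

lemma column_norm_nonneg [simp]: "0 \<le> column_norm u v"
  by (simp add: column_norm_def)

lemma norm_fst_le_column_norm: "norm u \<le> column_norm u v"
  using norm_star_mult_le_sum[of u v] by (simp add: column_norm_def real_le_rsqrt)

lemma norm_snd_le_column_norm: "norm v \<le> column_norm u v"
  using norm_star_mult_le_sum[of v u] by (simp add: column_norm_def real_le_rsqrt add.commute)

text \<open>The parallelogram law, of which the term with \<open>u - v\<close> is dropped by positivity.\<close>

lemma norm_add_sq_le_column_norm: "(norm (u + v))\<^sup>2 \<le> 2 * (column_norm u v)\<^sup>2"
proof -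
  have "star (u + v) * (u + v) + star (u - v) * (u - v) = 2 *\<^sub>R (star u * u + star v * v)"
    by (simp add: star_add star_diff algebra_simps scaleR_2)
  then show ?thesis
    using norm_star_mult_le_sum[of "u + v" "u - v"] by (simp add: column_norm_def)
qed

lemma column_norm_le: "column_norm u v \<le> norm u + norm v"
proof (rule power2_le_imp_le)
  have "norm (star u * u + star v * v) \<le> (norm u)\<^sup>2 + (norm v)\<^sup>2"
    by (rule norm_triangle_le) (simp add: cstar_identity)
  also have "\<dots> \<le> (norm u + norm v)\<^sup>2"
    by (simp add: power2_sum)
  finally show "(column_norm u v)\<^sup>2 \<le> (norm u + norm v)\<^sup>2"
    by (simp add: column_norm_def)
qed simp

lemma column_norm_scaleC: "column_norm (c *\<^sub>C u) (c *\<^sub>C v) = cmod c * column_norm u v"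
proof -
  have "star (c *\<^sub>C u) * (c *\<^sub>C u) + star (c *\<^sub>C v) * (c *\<^sub>C v)
      = (cnj c * c) *\<^sub>C (star u * u + star v * v)"
    by (simp add: star_scaleC mult_scaleC_left mult_scaleC_right scaleC_scaleC scaleC_add_right
        mult.commute)
  then show ?thesis
    by (simp add: column_norm_def norm_scaleC real_sqrt_mult norm_mult)
qed

lemma column_norm_scaleR: "column_norm (r *\<^sub>R u) (r *\<^sub>R v) = \<bar>r\<bar> * column_norm u v"
  by (simp add: scaleR_scaleC column_norm_scaleC)

text \<open>
  The supremum in the definition of the matrix norm is that of a bounded set: the entries of a
  column in the unit ball have norm at most \<open>1\<close>.
\<close>

lemma column_norm_le_mat2_norm_unit:
  assumes "column_norm u v \<le> 1"
  shows "column_norm (e11 A * u + e12 A * v) (e21 A * u + e22 A * v) \<le> mat2_norm A"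
proof -
  let ?C = "norm (e11 A) + norm (e12 A) + (norm (e21 A) + norm (e22 A))"
  have "column_norm (e11 A * u + e12 A * v) (e21 A * u + e22 A * v) \<le> ?C"
    if "column_norm u v \<le> 1" for u v
  proof -
    have "norm u \<le> 1" "norm v \<le> 1"
      using that norm_fst_le_column_norm[of u v] norm_snd_le_column_norm[of v u] by linarith+
    then have le: "norm (a * u) \<le> norm a" "norm (a * v) \<le> norm a" for a
      using norm_mult_ineq[of a u] norm_mult_ineq[of a v]
        mult_left_le[of "norm u" "norm a"] mult_left_le[of "norm v" "norm a"] by auto
    have "norm (a * u + b * v) \<le> norm a + norm b" for a b
      using norm_triangle_ineq[of "a * u" "b * v"] le(1)[of a] le(2)[of b] by linarith
    then show ?thesis
      by (intro order_trans[OF column_norm_le] add_mono)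
  qed
  then have "bdd_above ((\<lambda>(u, v). column_norm (e11 A * u + e12 A * v) (e21 A * u + e22 A * v))
      ` {(u, v). column_norm u v \<le> 1})"
    by (auto intro!: bdd_aboveI[of _ ?C])
  then show ?thesis
    unfolding mat2_norm_def
    using cSUP_upper[of "(u, v)" "{(u, v). column_norm u v \<le> 1}"
        "\<lambda>(u, v). column_norm (e11 A * u + e12 A * v) (e21 A * u + e22 A * v)"] assms
    by simp
qed

lemma column_norm_zero [simp]: "column_norm 0 0 = 0"
  by (simp add: column_norm_def)

lemma mat2_norm_nonneg [simp]: "0 \<le> mat2_norm A"
  using column_norm_le_mat2_norm_unit[of 0 0 A] by simp

lemma mat2_norm_le:
  assumes "\<And>u v. column_norm u v \<le> 1 \<Longrightarrow>
    column_norm (e11 A * u + e12 A * v) (e21 A * u + e22 A * v) \<le> c"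
  shows "mat2_norm A \<le> c"
  unfolding mat2_norm_def
proof (rule cSUP_least)
  have "(0, 0) \<in> {(u :: 'a, v :: 'a). column_norm u v \<le> 1}"
    by simp
  then show "{(u :: 'a, v :: 'a). column_norm u v \<le> 1} \<noteq> {}"
    by blast
qed (use assms in auto)

text \<open>
  The source of the second-order norm estimates for matrices below. Applied to a column, the hypothesis becomes
  an identity of positive elements of \<open>B\<close>, and dropping the term from \<open>Z\<close> can only
  decrease the norm. It is used with suitable \<open>Y\<close>, \<open>Z\<close> and \<open>W\<close> in place of the C*-identity and the
  triangle inequality of \<open>M\<^sub>2(B)\<close>.
\<close>

lemma mat2_norm_sq_le:
  assumes "star X * X + star Z * Z = star Y * Y + star W * W"
  shows "(mat2_norm X)\<^sup>2 \<le> (mat2_norm Y)\<^sup>2 + (mat2_norm W)\<^sup>2"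
proof -
  have "mat2_norm X \<le> sqrt ((mat2_norm Y)\<^sup>2 + (mat2_norm W)\<^sup>2)"
  proof (rule mat2_norm_le, rule real_le_rsqrt)
    fix u v :: 'a
    assume uv: "column_norm u v \<le> 1"
    define ip where "ip T = column_inner (mat2_apply T (u, v)) (mat2_apply T (u, v))" for T
    have ip: "ip T = column_inner (u, v) (mat2_apply (star T * T) (u, v))" for T
      by (simp add: ip_def column_inner_mat2_apply mat2_apply_mult)
    have norm_ip: "norm (ip T) = (column_norm (e11 T * u + e12 T * v) (e21 T * u + e22 T * v))\<^sup>2" for T
      by (simp add: column_norm_sq ip_def mat2_apply_def)
    have norm_ip_le: "norm (ip T) \<le> (mat2_norm T)\<^sup>2" for T
      unfolding norm_ip by (intro power_mono column_norm_le_mat2_norm_unit uv) simp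
    have "ip X + ip Z = ip Y + ip W"
      using assms unfolding ip by (simp flip: column_inner_add_right mat2_apply_add)
    then have "ip Y + ip W - ip X = ip Z"
      by (metis add_diff_cancel_left')
    then have "positive_element (ip Y + ip W - ip X)"
      by (simp add: ip_def positive_column_inner)
    then have "norm (ip X) \<le> norm (ip Y + ip W)"
      using positive_column_inner[of "mat2_apply X (u, v)"]
      by (intro norm_mono_positive) (simp_all add: ip_def)
    also have "\<dots> \<le> (mat2_norm Y)\<^sup>2 + (mat2_norm W)\<^sup>2"
      by (intro norm_triangle_le add_mono norm_ip_le)
    finally show "(column_norm (e11 X * u + e12 X * v) (e21 X * u + e22 X * v))\<^sup>2
        \<le> (mat2_norm Y)\<^sup>2 + (mat2_norm W)\<^sup>2"
      by (simp add: norm_ip)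
  qed
  then show ?thesis
    using power_mono[OF _ mat2_norm_nonneg, of X _ 2] by fastforce
qed

lemma mat2_norm_scaleC_le: "mat2_norm (c *\<^sub>C A) \<le> cmod c * mat2_norm A"
proof (rule mat2_norm_le)
  fix u v :: 'a
  assume uv: "column_norm u v \<le> 1"
  let ?p = "e11 A * u + e12 A * v" and ?q = "e21 A * u + e22 A * v"
  have "column_norm (c *\<^sub>C ?p) (c *\<^sub>C ?q) = cmod c * column_norm ?p ?q"
    by (rule column_norm_scaleC)
  also have "\<dots> \<le> cmod c * mat2_norm A"
    by (intro mult_left_mono column_norm_le_mat2_norm_unit uv) simp
  finally show "column_norm (e11 (c *\<^sub>C A) * u + e12 (c *\<^sub>C A) * v) (e21 (c *\<^sub>C A) * u + e22 (c *\<^sub>C A) * v)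
      \<le> cmod c * mat2_norm A"
    by (simp add: scaleC_mat2_def mult_scaleC_left scaleC_add_right)
qed

lemma mat2_norm_one_le: "mat2_norm 1 \<le> 1"
  by (rule mat2_norm_le) (simp add: one_mat2_def)

text \<open>
  The tensor product of \<open>b\<close> with the projection \<open>q\<close> of rank one onto the diagonal of the plane. Thus
  \<open>averaging 1\<close> is \<open>q\<close>, and \<open>averaging\<close> is an isomorphism of \<open>B\<close> onto the corner \<open>q M\<^sub>2(B) q\<close>.
\<close>

definition averaging :: "'b::cstar_algebra_1 \<Rightarrow> 'b mat2" where
  "averaging b = Mat2 ((1/2) *\<^sub>C b) ((1/2) *\<^sub>C b) ((1/2) *\<^sub>C b) ((1/2) *\<^sub>C b)"

lemma mat2_norm_averaging_le: "mat2_norm (averaging b) \<le> norm b"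
proof (rule mat2_norm_le, rule power2_le_imp_le)
  fix u v :: 'a
  assume uv: "column_norm u v \<le> 1"
  let ?w = "b * (u + v)"
  have half: "((1/2) *\<^sub>C b) * u + ((1/2) *\<^sub>C b) * v = (1/2) *\<^sub>R ?w"
    by (simp add: scaleR_scaleC mult_scaleC_left scaleC_add_right distrib_left)
  have "(column_norm ?w ?w)\<^sup>2 = norm (2 *\<^sub>R (star ?w * ?w))"
    by (simp add: column_norm_def scaleR_2)
  also have "\<dots> = 2 * (norm ?w)\<^sup>2"
    by (simp only: norm_scaleR cstar_identity abs_numeral)
  finally have "(column_norm ((1/2) *\<^sub>R ?w) ((1/2) *\<^sub>R ?w))\<^sup>2 = (norm ?w)\<^sup>2 / 2"
    by (simp add: column_norm_scaleR power_divide)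
  also have "\<dots> \<le> (norm b * norm (u + v))\<^sup>2 / 2"
    by (intro divide_right_mono power_mono norm_mult_ineq) simp_all
  also have "\<dots> \<le> (norm b)\<^sup>2 * (column_norm u v)\<^sup>2"
    using mult_left_mono[OF norm_add_sq_le_column_norm[of u v], of "(norm b)\<^sup>2"]
    by (simp add: power_mult_distrib)
  also have "\<dots> \<le> (norm b)\<^sup>2 * 1"
    using uv by (intro mult_left_mono power_le_one) simp_all
  finally show "(column_norm (e11 (averaging b) * u + e12 (averaging b) * v)
      (e21 (averaging b) * u + e22 (averaging b) * v))\<^sup>2 \<le> (norm b)\<^sup>2"
    by (simp add: averaging_def half)
qed simp

text \<open>Evaluate the matrix at the unit column with entries \<open>1 / sqrt 2\<close>.\<close>

lemma norm_sum_entries_le: "norm (e11 A + e12 A + e21 A + e22 A) \<le> 2 * mat2_norm A"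
proof -
  let ?r = "1 / sqrt 2" and ?p = "e11 A + e12 A" and ?q = "e21 A + e22 A"
  have "(column_norm (1::'a) 1)\<^sup>2 = norm (2 *\<^sub>R (1::'a))"
    by (simp add: column_norm_def scaleR_2)
  then have "column_norm (1::'a) 1 = sqrt 2"
    by (metis column_norm_nonneg norm_scaleR norm_one abs_numeral mult_1_right real_sqrt_abs
        abs_of_nonneg)
  then have "column_norm (?r *\<^sub>R (1::'a)) (?r *\<^sub>R 1) \<le> 1"
    by (simp add: column_norm_scaleR)
  from column_norm_le_mat2_norm_unit[OF this, of A]
  have "column_norm (?r *\<^sub>R ?p) (?r *\<^sub>R ?q) \<le> mat2_norm A"
    by (simp only: mult_scaleR_right mult_1_right flip: scaleR_add_right)
  then have "column_norm ?p ?q \<le> sqrt 2 * mat2_norm A"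
    unfolding column_norm_scaleR by (simp add: field_simps)
  then have "(column_norm ?p ?q)\<^sup>2 \<le> (sqrt 2 * mat2_norm A)\<^sup>2"
    by (intro power_mono) simp_all
  then have "(norm (?p + ?q))\<^sup>2 \<le> (2 * mat2_norm A)\<^sup>2"
    using norm_add_sq_le_column_norm[of ?p ?q] by (simp add: power_mult_distrib)
  then have "norm (?p + ?q) \<le> 2 * mat2_norm A"
    by (rule power2_le_imp_le) simp
  then show ?thesis
    by (simp add: add.assoc)
qed

text \<open>
  The cross terms of \<open>(1 + da)*(1 + da)\<close> cancel against those of \<open>d(1 - a)*(1 - a)\<close>. The bound tends to
  \<open>1\<close> with \<open>d\<close>, which is all that is asked of it.
\<close>

lemma mat2_norm_one_add_sq_le:
  assumes "0 \<le> d"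
  shows "(mat2_norm (1 + of_real d *\<^sub>C a))\<^sup>2 \<le> (1 + d) + (d + d\<^sup>2) * (mat2_norm a)\<^sup>2"
proof -
  let ?r = "\<lambda>x A. of_real (sqrt x) *\<^sub>C A"
  let ?X = "1 + of_real d *\<^sub>C a"
  have r: "star (?r x A) * ?r x A = of_real x *\<^sub>C (star A * A)" if "0 \<le> x" for x and A :: "'a mat2"
    using that by (simp add: star_scaleC mult_scaleC_left mult_scaleC_right scaleC_scaleC flip: of_real_mult)
  have nonneg: "0 \<le> 1 + d" "0 \<le> d + d\<^sup>2"
    using assms by simp_all
  have "star ?X * ?X + star (?r d (1 - a)) * ?r d (1 - a)
      = star (?r (1 + d) 1) * ?r (1 + d) 1 + star (?r (d + d\<^sup>2) a) * ?r (d + d\<^sup>2) a"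
    unfolding r[OF assms] r[OF nonneg(1)] r[OF nonneg(2)]
    by (simp add: star_add star_diff star_scaleC mult_scaleC_left mult_scaleC_right scaleC_scaleC
        scaleC_add_right scaleC_add_left scaleC.scale_right_diff_distrib scaleC_one power2_eq_square algebra_simps)
  then have "(mat2_norm ?X)\<^sup>2 \<le> (mat2_norm (?r (1 + d) (1 :: 'a mat2)))\<^sup>2 + (mat2_norm (?r (d + d\<^sup>2) a))\<^sup>2"
    by (rule mat2_norm_sq_le)
  also have "\<dots> \<le> (sqrt (1 + d) * 1)\<^sup>2 + (sqrt (d + d\<^sup>2) * mat2_norm a)\<^sup>2"
  proof (intro add_mono power_mono mat2_norm_nonneg)
    have r_le: "mat2_norm (?r x A) \<le> sqrt x * mat2_norm A" if "0 \<le> x" for x and A :: "'a mat2"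
      using mat2_norm_scaleC_le[of "of_real (sqrt x)" A] that by simp
    show "mat2_norm (?r (d + d\<^sup>2) a) \<le> sqrt (d + d\<^sup>2) * mat2_norm a"
      using assms by (intro r_le) simp
    have "mat2_norm (?r (1 + d) (1 :: 'a mat2)) \<le> sqrt (1 + d) * mat2_norm (1 :: 'a mat2)"
      using assms by (intro r_le) simp
    also have "\<dots> \<le> sqrt (1 + d) * 1"
      using assms by (intro mult_left_mono mat2_norm_one_le) simp
    finally show "mat2_norm (?r (1 + d) (1 :: 'a mat2)) \<le> sqrt (1 + d) * 1" .
  qed
  also have "\<dots> = (1 + d) + (d + d\<^sup>2) * (mat2_norm a)\<^sup>2"
    using assms by (simp add: power_mult_distrib)
  finally show ?thesis .
qed

section \<open>Slices around a pure state\<close>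

lemma states_iff:
  "\<phi> \<in> states nrm \<longleftrightarrow> (\<forall>x y. \<phi> (x + y) = \<phi> x + \<phi> y) \<and> (\<forall>c x. \<phi> (c *\<^sub>C x) = c * \<phi> x)
    \<and> \<phi> 1 = 1 \<and> (\<forall>x. cmod (\<phi> x) \<le> nrm x)"
  by (auto simp: states_def Vector_Spaces.linear_iff vector_space_scaleC vector_space_complex)

lemma
  assumes "\<phi> \<in> states nrm"
  shows state_add: "\<phi> (x + y) = \<phi> x + \<phi> y"
    and state_scaleC: "\<phi> (c *\<^sub>C x) = c * \<phi> x"
    and state_one: "\<phi> 1 = 1"
    and state_bound: "cmod (\<phi> x) \<le> nrm x"
  using assms by (auto simp: states_iff)

lemma state_diff: "\<phi> \<in> states nrm \<Longrightarrow> \<phi> (x - y) = \<phi> x - \<phi> y"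
  using state_add[of \<phi> nrm "x - y" y] by simp

lemma state_zero: "\<phi> \<in> states nrm \<Longrightarrow> \<phi> 0 = 0"
  using state_diff[of \<phi> nrm 0 0] by simp

lemma state_sum: "\<phi> \<in> states nrm \<Longrightarrow> \<phi> (\<Sum>i\<in>I. f i) = (\<Sum>i\<in>I. \<phi> (f i))"
  by (induction I rule: infinite_finite_induct) (simp_all add: state_zero state_add)

text \<open>
  Functionals are plain functions here, so their convex structure is written out pointwise.
\<close>

definition mix :: "real \<Rightarrow> ('c \<Rightarrow> complex) \<Rightarrow> ('c \<Rightarrow> complex) \<Rightarrow> 'c \<Rightarrow> complex" where
  "mix t \<phi> \<psi> = (\<lambda>x. of_real t * \<phi> x + of_real (1 - t) * \<psi> x)"

definition mix_closed :: "('c \<Rightarrow> complex) set \<Rightarrow> bool" where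
  "mix_closed Q \<longleftrightarrow> (\<forall>\<phi>\<in>Q. \<forall>\<psi>\<in>Q. \<forall>t\<in>{0..1}. mix t \<phi> \<psi> \<in> Q)"

lemma mix_0 [simp]: "mix 0 \<phi> \<psi> = \<psi>" and mix_1 [simp]: "mix 1 \<phi> \<psi> = \<phi>"
  by (simp_all add: mix_def)

lemma mix_states:
  assumes "\<phi> \<in> states nrm" "\<psi> \<in> states nrm" "t \<in> {0..1}"
  shows "mix t \<phi> \<psi> \<in> states nrm"
proof -
  have "cmod (mix t \<phi> \<psi> x) \<le> nrm x" for x
  proof -
    have "cmod (mix t \<phi> \<psi> x) \<le> t * cmod (\<phi> x) + (1 - t) * cmod (\<psi> x)"
      using norm_triangle_ineq[of "of_real t * \<phi> x" "of_real (1 - t) * \<psi> x"] assms(3)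
      unfolding mix_def norm_mult norm_of_real by simp
    also have "\<dots> \<le> t * nrm x + (1 - t) * nrm x"
      using assms by (intro add_mono mult_left_mono state_bound) auto
    finally show ?thesis
      by (simp add: algebra_simps)
  qed
  then show ?thesis
    using assms by (simp add: states_iff mix_def algebra_simps)
qed

lemma continuous_on_eval [continuous_intros]:
  "continuous_on A (\<lambda>\<phi> :: 'c \<Rightarrow> complex. \<phi> x)"
  by (rule continuous_on_product_then_coordinatewise[OF continuous_on_id])

text \<open>The Banach-Alaoglu argument: a closed subset of a product of discs.\<close>

lemma compact_states: "compact (states nrm)"
proof -
  let ?B = "PiE UNIV (\<lambda>x. cball (0::complex) (nrm x))"
  have "compactin (product_topology (\<lambda>i. euclidean) UNIV) ?B"
    by (simp add: compactin_PiE)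
  then have "compact ?B"
    by (simp add: euclidean_product_topology)
  moreover have "closed {\<phi> :: 'a \<Rightarrow> complex. (\<forall>x y. \<phi> (x + y) = \<phi> x + \<phi> y)
      \<and> (\<forall>c x. \<phi> (c *\<^sub>C x) = c * \<phi> x) \<and> \<phi> 1 = 1}" (is "closed ?L")
    by (intro closed_Collect_conj closed_Collect_all closed_Collect_eq continuous_intros)
  moreover have "states nrm = ?B \<inter> ?L"
    by (rule set_eqI) (simp add: states_iff PiE_iff conj_ac)
  ultimately show ?thesis
    using compact_Int_closed by (simp only:)
qed

lemma compact_join:
  assumes "compact P" and "compact (Q :: ('c \<Rightarrow> complex) set)"
  shows "compact ((\<lambda>(t, \<phi>, \<psi>). mix t \<phi> \<psi>) ` ({0..1} \<times> P \<times> Q))"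
proof (rule compact_continuous_image)
  show "compact ({0..1::real} \<times> P \<times> Q)"
    using assms by (intro compact_Times compact_Icc)
  show "continuous_on ({0..1} \<times> P \<times> Q) (\<lambda>(t, \<phi>, \<psi>). mix t \<phi> \<psi>)"
    unfolding split_beta
  proof (rule continuous_on_coordinatewise_then_product)
    fix x :: 'c
    let ?A = "{0..1::real} \<times> P \<times> Q"
    have "continuous_on ?A (\<lambda>z. fst (snd z) x)" "continuous_on ?A (\<lambda>z. snd (snd z) x)"
      by (rule continuous_on_product_then_coordinatewise, intro continuous_intros)+
    then show "continuous_on ?A (\<lambda>z. mix (fst z) (fst (snd z)) (snd (snd z)) x)"
      unfolding mix_def
      by (intro continuous_on_add continuous_on_mult continuous_on_of_real continuous_on_diff
          continuous_on_fst continuous_on_id continuous_on_const)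
  qed
qed

text \<open>
  Two weights that need not add up to \<open>1\<close>. The case that both vanish, in which any point will do, is
  what makes this form convenient for nested convex combinations.
\<close>

lemma mix_closed_weighted:
  assumes "mix_closed P" "\<phi> \<in> P" "\<psi> \<in> P" "0 \<le> p" "0 \<le> q"
  obtains \<kappa> where "\<kappa> \<in> P" "\<And>x. of_real (p + q) * \<kappa> x = of_real p * \<phi> x + of_real q * \<psi> x"
proof (cases "p + q = 0")
  case True
  then have "p = 0" "q = 0"
    using assms(4,5) by auto
  then show ?thesis
    using that[OF assms(2)] by simp
next
  case False
  let ?t = "p / (p + q)"
  have compl: "1 - ?t = q / (p + q)"
    using False by (simp add: field_simps)
  have "?t \<in> {0..1}"
    using assms(4,5) False by simp
  then have "mix ?t \<phi> \<psi> \<in> P"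
    using assms(1-3) by (simp add: mix_closed_def)
  moreover have "of_real (p + q) * mix ?t \<phi> \<psi> x = of_real p * \<phi> x + of_real q * \<psi> x" for x
  proof -
    have "of_real (p + q) * mix ?t \<phi> \<psi> x
        = of_real ((p + q) * ?t) * \<phi> x + of_real ((p + q) * (q / (p + q))) * \<psi> x"
      unfolding mix_def compl of_real_mult by (simp only: distrib_left mult.assoc)
    then show ?thesis
      using False by simp
  qed
  ultimately show ?thesis
    by (rule that)
qed

text \<open>
  A convex combination of two segments between \<open>P\<close> and \<open>Q\<close> is obtained by collecting the weights
  that fall on \<open>P\<close> and those that fall on \<open>Q\<close>.
\<close>

lemma mix_closed_join:
  assumes "mix_closed P" and "mix_closed Q"
  shows "mix_closed ((\<lambda>(t, \<phi>, \<psi>). mix t \<phi> \<psi>) ` ({0..1} \<times> P \<times> Q))"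
    (is "mix_closed ?J")
  unfolding mix_closed_def
proof (intro ballI)
  fix \<alpha> \<beta> :: "'a \<Rightarrow> complex" and s :: real
  assume "\<alpha> \<in> ?J" "\<beta> \<in> ?J" and s: "s \<in> {0..1}"
  then obtain a \<phi> \<psi> b \<phi>' \<psi>' where a: "a \<in> {0..1}" "\<phi> \<in> P" "\<psi> \<in> Q" "\<alpha> = mix a \<phi> \<psi>"
    and b: "b \<in> {0..1}" "\<phi>' \<in> P" "\<psi>' \<in> Q" "\<beta> = mix b \<phi>' \<psi>'"
    by auto
  let ?t = "s * a + (1 - s) * b"
  obtain \<kappa> where \<kappa>: "\<kappa> \<in> P"
    "\<And>x. of_real ?t * \<kappa> x = of_real (s * a) * \<phi> x + of_real ((1 - s) * b) * \<phi>' x"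
    using mix_closed_weighted[OF assms(1) a(2) b(2), of "s * a" "(1 - s) * b"] a(1) b(1) s
    by auto
  obtain \<zeta> where \<zeta>: "\<zeta> \<in> Q"
    "\<And>x. of_real (s * (1 - a) + (1 - s) * (1 - b)) * \<zeta> x
      = of_real (s * (1 - a)) * \<psi> x + of_real ((1 - s) * (1 - b)) * \<psi>' x"
    using mix_closed_weighted[OF assms(2) a(3) b(3), of "s * (1 - a)" "(1 - s) * (1 - b)"]
      a(1) b(1) s
    by auto
  have "1 - ?t = s * (1 - a) + (1 - s) * (1 - b)"
    by (simp add: algebra_simps)
  then have "mix ?t \<kappa> \<zeta> x = (of_real (s * a) * \<phi> x + of_real ((1 - s) * b) * \<phi>' x)
      + (of_real (s * (1 - a)) * \<psi> x + of_real ((1 - s) * (1 - b)) * \<psi>' x)" for x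
    unfolding mix_def[of ?t] by (simp only: \<kappa>(2) \<zeta>(2))
  then have "mix ?t \<kappa> \<zeta> = mix s \<alpha> \<beta>"
    by (intro ext) (simp add: mix_def a(4) b(4) algebra_simps)
  moreover have "?t \<in> {0..1}"
    using convex_bound_le[of a 1 b s "1 - s"] a(1) b(1) s by auto
  ultimately show "mix s \<alpha> \<beta> \<in> ?J"
    using \<kappa>(1) \<zeta>(1) by (intro image_eqI[of _ _ "(?t, \<kappa>, \<zeta>)"]) auto
qed

lemma pure_state_not_mix:
  assumes "pure_state nrm \<theta>" "\<phi> \<in> states nrm - {\<theta>}" "\<psi> \<in> states nrm - {\<theta>}" "t \<in> {0..1}"
  shows "mix t \<phi> \<psi> \<noteq> \<theta>"
proof
  assume eq: "mix t \<phi> \<psi> = \<theta>"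
  then have "t \<noteq> 0" "t \<noteq> 1"
    using assms(2,3) by auto
  then have "0 < t \<and> t < 1 \<and> (\<forall>x. \<theta> x = of_real t * \<phi> x + of_real (1 - t) * \<psi> x)"
    using assms(4) eq by (auto simp: mix_def)
  then have "\<phi> = \<theta>"
    using assms(1-3) unfolding pure_state_def by blast
  then show False
    using assms(2) by simp
qed

lemma closed_Re_le: "closed {\<phi> :: 'c \<Rightarrow> complex. Re (\<phi> b) \<le> r}"
  by (intro closed_Collect_le continuous_intros)

lemma open_Re_less: "open {\<phi> :: 'c \<Rightarrow> complex. Re (\<phi> b) < r}"
  by (intro open_Collect_less continuous_intros)

text \<open>
  The convex hull of finitely many compact convex sets of states, each cut off by a half-space that
  misses \<open>\<theta>\<close>, is again compact and misses \<open>\<theta>\<close>. It is built by joining one set at a time: joins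
  are compact, and an extreme point lies on no segment between two other states. This is Milman's
  partial converse of the Krein-Milman theorem.
\<close>

lemma pure_state_hull:
  fixes \<theta> :: "'c::complex_star_algebra_1 \<Rightarrow> complex"
  assumes "pure_state nrm \<theta>" and "finite F"
  obtains Q where "compact Q" "mix_closed Q" "Q \<subseteq> states nrm - {\<theta>}"
    "\<And>b. b \<in> F \<Longrightarrow> {\<phi> \<in> states nrm. Re (\<phi> b) \<le> Re (\<theta> b) - 1} \<subseteq> Q"
proof -
  let ?H = "\<lambda>b. {\<phi> \<in> states nrm. Re (\<phi> b) \<le> Re (\<theta> b) - 1}"
  have H: "compact (?H b)" "mix_closed (?H b)" "?H b \<subseteq> states nrm - {\<theta>}" for b
  proof -
    have "?H b = states nrm \<inter> {\<phi>. Re (\<phi> b) \<le> Re (\<theta> b) - 1}"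
      by auto
    then show "compact (?H b)"
      using compact_Int_closed[OF compact_states closed_Re_le] by metis
    have "Re (mix t \<phi> \<psi> b) \<le> r" if "t \<in> {0..1}" "Re (\<phi> b) \<le> r" "Re (\<psi> b) \<le> r" for t \<phi> \<psi> r
      using convex_bound_le[OF that(2,3), of t "1 - t"] that(1) by (simp add: mix_def)
    then show "mix_closed (?H b)"
      by (auto simp: mix_closed_def mix_states)
    show "?H b \<subseteq> states nrm - {\<theta>}"
      by auto
  qed
  have "\<exists>Q. compact Q \<and> mix_closed Q \<and> Q \<subseteq> states nrm - {\<theta>} \<and> (\<forall>b\<in>F. ?H b \<subseteq> Q)"
    using assms(2)
  proof induction
    case empty
    then show ?case
      by (intro exI[of _ "{}"]) (simp add: mix_closed_def)
  next
    case (insert b F)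
    then obtain Q where Q: "compact Q" "mix_closed Q" "Q \<subseteq> states nrm - {\<theta>}" "\<forall>b\<in>F. ?H b \<subseteq> Q"
      by blast
    show ?case
    \<comment> \<open>The join with an empty set is empty and would lose the other set.\<close>
    proof (cases "Q = {} \<or> ?H b = {}")
      case True
      then show ?thesis
      proof
        assume "Q = {}"
        then show ?thesis
          using H[of b] Q(4) by (intro exI[of _ "?H b"]) blast
      next
        assume "?H b = {}"
        then show ?thesis
          using Q by (intro exI[of _ Q]) blast
      qed
    next
      case False
      then obtain \<phi>0 \<psi>0 where ne: "\<phi>0 \<in> Q" "\<psi>0 \<in> ?H b"
        by blast
      let ?J = "(\<lambda>(t, \<phi>, \<psi>). mix t \<phi> \<psi>) ` ({0..1} \<times> Q \<times> ?H b)"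
      have "compact ?J"
        using Q(1) H(1) by (rule compact_join)
      moreover have "mix_closed ?J"
        using Q(2) H(2) by (rule mix_closed_join)
      moreover have "?J \<subseteq> states nrm - {\<theta>}"
      proof
        fix \<kappa>
        assume "\<kappa> \<in> ?J"
        then obtain t \<phi> \<psi> where *: "t \<in> {0..1}" "\<phi> \<in> Q" "\<psi> \<in> ?H b" "\<kappa> = mix t \<phi> \<psi>"
          by auto
        then have "\<phi> \<in> states nrm - {\<theta>}" "\<psi> \<in> states nrm - {\<theta>}"
          using Q(3) H(3) by blast+
        then show "\<kappa> \<in> states nrm - {\<theta>}"
          using * pure_state_not_mix[OF assms(1)] by (simp add: mix_states)
      qed
      moreover have "Q \<subseteq> ?J"
        using ne(2) by (auto intro!: image_eqI[of _ _ "(1, _, \<psi>0)"])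
      moreover have "?H b \<subseteq> ?J"
        using ne(1) by (auto intro!: image_eqI[of _ _ "(0, \<phi>0, _)"])
      ultimately show ?thesis
        using Q(4) by (intro exI[of _ ?J]) blast
    qed
  qed
  then show ?thesis
    using that by blast
qed

text \<open>The element can be scaled by a complex number, so that the gap is real and equal to \<open>2\<close>.\<close>

lemma states_differ_Re:
  assumes "\<phi> \<in> states nrm" "\<theta> \<in> states nrm" "\<phi> \<noteq> \<theta>"
  shows "\<exists>b. Re (\<phi> b) < Re (\<theta> b) - 1"
proof -
  obtain x where "\<phi> x \<noteq> \<theta> x"
    using assms(3) by blast
  define c where "c = 2 / (\<theta> x - \<phi> x)"
  have "\<theta> (c *\<^sub>C x) - \<phi> (c *\<^sub>C x) = c * (\<theta> x - \<phi> x)"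
    by (simp only: state_scaleC[OF assms(1)] state_scaleC[OF assms(2)] right_diff_distrib)
  also have "\<dots> = 2"
    using \<open>\<phi> x \<noteq> \<theta> x\<close> unfolding c_def by (intro nonzero_eq_divide_eq[THEN iffD1]) auto
  finally have "Re (\<theta> (c *\<^sub>C x)) - Re (\<phi> (c *\<^sub>C x)) = 2"
    by (metis minus_complex.simps(1) complex_Re_numeral)
  then show ?thesis
    by (intro exI[of _ "c *\<^sub>C x"]) linarith
qed

text \<open>
  A separation theorem without the Hahn-Banach theorem. By compactness, finitely many elements of
  \<open>N\<close> suffice to tell \<open>\<theta>\<close> from all points of \<open>Q\<close>; the point \<open>\<psi>\<close> of \<open>Q\<close> that is nearest to \<open>\<theta>\<close> in
  the Euclidean seminorm given by these elements then determines the separating hyperplane, just as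
  for a closed convex set in a Hilbert space.
\<close>

lemma separate_from_mix_closed:
  assumes "unital_subspace N" "\<theta> \<in> states nrm" "compact Q" "mix_closed Q" "Q \<subseteq> states nrm"
    and "\<And>\<phi>. \<phi> \<in> Q \<Longrightarrow> \<exists>x\<in>N. \<phi> x \<noteq> \<theta> x"
  obtains a m where "a \<in> N" "m > 0" "Re (\<theta> a) \<ge> m" "\<And>\<phi>. \<phi> \<in> Q \<Longrightarrow> Re (\<phi> a) \<le> - m"
proof (cases "Q = {}")
  case True
  then show ?thesis
    using that[of 1 1] assms(1,2) by (simp add: unital_subspace_def state_one)
next
  case False
  have sub: "scaleC.subspace N" and one: "1 \<in> N"
    using assms(1) by (auto simp: unital_subspace_def)
  have "open {\<phi> :: 'a \<Rightarrow> complex. \<phi> x \<noteq> \<theta> x}" for x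
    by (intro open_Collect_neq continuous_intros)
  moreover have "Q \<subseteq> (\<Union>x\<in>N. {\<phi>. \<phi> x \<noteq> \<theta> x})"
    using assms(6) by blast
  ultimately obtain F where F: "F \<subseteq> N" "finite F" "Q \<subseteq> (\<Union>x\<in>F. {\<phi>. \<phi> x \<noteq> \<theta> x})"
    using compactE_image[OF assms(3), of N "\<lambda>x. {\<phi>. \<phi> x \<noteq> \<theta> x}"] by blast
  define f where "f \<phi> = (\<Sum>x\<in>F. (cmod (\<phi> x - \<theta> x))\<^sup>2)" for \<phi>
  have "continuous_on Q f"
    unfolding f_def by (intro continuous_intros)
  then obtain \<psi> where \<psi>: "\<psi> \<in> Q" "\<And>\<phi>. \<phi> \<in> Q \<Longrightarrow> f \<psi> \<le> f \<phi>"
    using continuous_attains_inf[OF assms(3) False] by blast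
  define d where "d x = \<theta> x - \<psi> x" for x
  have "f \<psi> > 0"
  proof -
    obtain x where "x \<in> F" "\<psi> x \<noteq> \<theta> x"
      using F(3) \<psi>(1) by blast
    then show ?thesis
      unfolding f_def using F(2) by (intro sum_pos2[of _ x]) auto
  qed
  define a where "a = (\<Sum>x\<in>F. cnj (d x) *\<^sub>C x)"
  have "a \<in> N"
    unfolding a_def using F(1) by (intro scaleC.subspace_sum sub scaleC.subspace_scale) auto
  have apply_a: "\<phi> a = (\<Sum>x\<in>F. cnj (d x) * \<phi> x)" if "\<phi> \<in> states nrm" for \<phi>
    using that by (simp add: a_def state_sum state_scaleC)
  have \<psi>_state: "\<psi> \<in> states nrm"
    using \<psi>(1) assms(5) by blast
  have "\<theta> a - \<psi> a = (\<Sum>x\<in>F. cnj (d x) * d x)"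
    unfolding apply_a[OF assms(2)] apply_a[OF \<psi>_state]
    by (simp add: d_def algebra_simps flip: sum_subtractf)
  also have "\<dots> = of_real (f \<psi>)"
    unfolding f_def d_def norm_minus_commute[of "\<psi> _"]
    by (simp only: of_real_sum complex_norm_square mult.commute)
  finally have gap: "Re (\<theta> a) - Re (\<psi> a) = f \<psi>"
    by (metis Re_complex_of_real minus_complex.simps(1))
  have le: "Re (\<phi> a) \<le> Re (\<psi> a)" if "\<phi> \<in> Q" for \<phi>
  proof (rule ccontr)
    define e where "e x = \<phi> x - \<psi> x" for x
    define R where "R = (\<Sum>x\<in>F. Re (cnj (d x) * e x))"
    define E where "E = (\<Sum>x\<in>F. (cmod (e x))\<^sup>2)"
    have \<phi>_state: "\<phi> \<in> states nrm"
      using that assms(5) by blast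
    have R: "Re (\<phi> a) - Re (\<psi> a) = R"
      unfolding apply_a[OF \<phi>_state] apply_a[OF \<psi>_state] R_def e_def
      by (simp add: right_diff_distrib sum_subtractf)
    assume "\<not> Re (\<phi> a) \<le> Re (\<psi> a)"
    then have "R > 0"
      using R by simp
    have "E \<ge> 0"
      by (simp add: E_def sum_nonneg)
    \<comment> \<open>A step of length \<open>t\<close> from \<open>\<psi>\<close> towards \<open>\<phi>\<close> changes \<open>f\<close> by \<open>t\<^sup>2 E - 2tR\<close>, which is negative
      for this choice, against the minimality of \<open>f\<close> at \<open>\<psi>\<close>.\<close>
    define t where "t = min 1 (R / (E + 1))"
    have t: "t \<in> {0..1}" "t > 0"
      using \<open>R > 0\<close> \<open>E \<ge> 0\<close> by (auto simp: t_def)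
    have "t * E \<le> R"
    proof -
      have "t * E \<le> R / (E + 1) * E"
        using \<open>E \<ge> 0\<close> by (intro mult_right_mono) (simp_all add: t_def)
      also have "\<dots> \<le> R"
        using \<open>R > 0\<close> \<open>E \<ge> 0\<close> by (simp add: field_simps)
      finally show ?thesis .
    qed
    have expand: "(cmod (mix t \<phi> \<psi> x - \<theta> x))\<^sup>2
        = (cmod (\<psi> x - \<theta> x))\<^sup>2 - 2 * t * Re (cnj (d x) * e x) + t\<^sup>2 * (cmod (e x))\<^sup>2" for x
    proof -
      have "mix t \<phi> \<psi> x - \<theta> x = of_real t * e x - d x" "\<psi> x - \<theta> x = - d x"
        by (simp_all add: mix_def e_def d_def algebra_simps)
      then show ?thesis
        by (simp only: cmod_power2) (simp add: power2_eq_square algebra_simps)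
    qed
    have "f (mix t \<phi> \<psi>) = f \<psi> - 2 * t * R + t\<^sup>2 * E"
      by (simp only: f_def expand sum.distrib sum_subtractf sum_distrib_left R_def E_def)
    moreover have "t\<^sup>2 * E \<le> t * R"
      using \<open>t * E \<le> R\<close> t(2) by (simp add: power2_eq_square mult.assoc)
    moreover have "t * R > 0"
      using t(2) \<open>R > 0\<close> by simp
    moreover have "f \<psi> \<le> f (mix t \<phi> \<psi>)"
      using assms(4) that \<psi> t(1) by (simp add: mix_closed_def)
    ultimately show False
      by linarith
  qed
  \<comment> \<open>A multiple of \<open>1\<close> moves the threshold to the middle of the gap.\<close>
  define c where "c = Re (\<psi> a) + f \<psi> / 2"
  have "a - of_real c *\<^sub>C 1 \<in> N"
    by (intro scaleC.subspace_diff scaleC.subspace_scale sub one \<open>a \<in> N\<close>)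
  moreover have "Re (\<phi> (a - of_real c *\<^sub>C 1)) = Re (\<phi> a) - c" if "\<phi> \<in> states nrm" for \<phi>
    using that by (simp add: state_diff state_scaleC state_one)
  ultimately show ?thesis
    using that[of "a - of_real c *\<^sub>C 1" "f \<psi> / 2"] \<open>f \<psi> > 0\<close> gap le assms(2,5)
    by (auto simp: c_def subset_iff)
qed

text \<open>
  Cover \<open>K\<close> by finitely many half-spaces that miss \<open>\<theta>\<close> and enlarge it to a compact convex set of
  states that still misses \<open>\<theta>\<close>. Uniqueness of the extension means that every point of this set
  differs from \<open>\<theta>\<close> on \<open>N\<close>, so that it can be separated from \<open>\<theta>\<close> by an element of \<open>N\<close>.
\<close>

theorem pure_state_slice:
  assumes "unital_subspace N" "pure_state nrm \<theta>" "state_extensions nrm N \<theta> = {\<theta>}"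
    and "compact K" "K \<subseteq> states nrm - {\<theta>}"
  obtains a m where "a \<in> N" "m > 0" "Re (\<theta> a) \<ge> m" "\<And>\<psi>. \<psi> \<in> K \<Longrightarrow> Re (\<psi> a) \<le> - m"
proof -
  have \<theta>: "\<theta> \<in> states nrm"
    using assms(2) by (simp add: pure_state_def)
  define U where "U b = {\<phi>. Re (\<phi> b) < Re (\<theta> b) - 1}" for b
  have "\<exists>b. \<psi> \<in> U b" if "\<psi> \<in> K" for \<psi>
  proof -
    have "\<psi> \<in> states nrm" "\<psi> \<noteq> \<theta>"
      using that assms(5) by auto
    then show ?thesis
      using states_differ_Re[OF _ \<theta>] by (simp add: U_def)
  qed
  then have cover: "K \<subseteq> (\<Union>b\<in>UNIV. U b)"
    by blast
  have "open (U b)" for b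
    by (simp add: U_def open_Re_less)
  then obtain F where F: "finite F" "K \<subseteq> (\<Union>b\<in>F. U b)"
    using compactE_image[OF assms(4) _ cover] by metis
  obtain Q where Q: "compact Q" "mix_closed Q" "Q \<subseteq> states nrm - {\<theta>}"
    "\<And>b. b \<in> F \<Longrightarrow> {\<phi> \<in> states nrm. Re (\<phi> b) \<le> Re (\<theta> b) - 1} \<subseteq> Q"
    using pure_state_hull[OF assms(2) F(1)] by blast
  have "K \<subseteq> Q"
  proof
    fix \<phi>
    assume "\<phi> \<in> K"
    then obtain b where "b \<in> F" "Re (\<phi> b) < Re (\<theta> b) - 1"
      using F(2) unfolding U_def by blast
    then show "\<phi> \<in> Q"
      using Q(4)[of b] \<open>\<phi> \<in> K\<close> assms(5) by force
  qed
  moreover have "\<exists>x\<in>N. \<phi> x \<noteq> \<theta> x" if "\<phi> \<in> Q" for \<phi>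
  proof (rule ccontr)
    assume "\<not> (\<exists>x\<in>N. \<phi> x \<noteq> \<theta> x)"
    then have "\<phi> \<in> state_extensions nrm N \<theta>"
      using that Q(3) by (auto simp: state_extensions_def)
    then show False
      using assms(3) that Q(3) by auto
  qed
  then obtain a m where "a \<in> N" "m > 0" "Re (\<theta> a) \<ge> m" "\<And>\<phi>. \<phi> \<in> Q \<Longrightarrow> Re (\<phi> a) \<le> - m"
    using separate_from_mix_closed[OF assms(1) \<theta> Q(1,2)] Q(3) by blast
  ultimately show ?thesis
    using that by blast
qed

section \<open>States on two-by-two matrices\<close>

text \<open>
  For selfadjoint \<open>H\<close> the norm of \<open>H + it\<close> squared is at most the norm of \<open>H\<close> squared plus \<open>t\<^sup>2\<close>,
  but an imaginary part \<open>b \<noteq> 0\<close> of \<open>\<Psi>(H)\<close> would make \<open>|\<Psi>(H + it)|\<^sup>2\<close> grow like \<open>t\<^sup>2 + 2bt\<close>.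
\<close>

lemma mat2_state_selfadjoint_real:
  assumes "\<Psi> \<in> states mat2_norm" and "star H = H"
  shows "Im (\<Psi> H) = 0"
proof (rule ccontr)
  define b where "b = Im (\<Psi> H)"
  define C where "C = mat2_norm H"
  define t where "t = (C\<^sup>2 + 1) / (2 * b)"
  assume "Im (\<Psi> H) \<noteq> 0"
  then have "b \<noteq> 0"
    by (simp add: b_def)
  let ?X = "H + (\<i> * of_real t) *\<^sub>C 1"
  have "star ?X * ?X + star 0 * 0 = star H * H + star (of_real t *\<^sub>C 1) * (of_real t *\<^sub>C 1)"
    using assms(2)
    by (simp add: star_add star_scaleC algebra_simps mult_scaleC_left mult_scaleC_right
        scaleC_scaleC scaleC_add_right scaleC.scale_minus_left)
  then have "(mat2_norm ?X)\<^sup>2 \<le> C\<^sup>2 + (mat2_norm (of_real t *\<^sub>C (1 :: 'a mat2)))\<^sup>2"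
    unfolding C_def by (rule mat2_norm_sq_le)
  also have "(mat2_norm (of_real t *\<^sub>C (1 :: 'a mat2)))\<^sup>2 \<le> \<bar>t\<bar>\<^sup>2"
  proof (rule power_mono)
    show "mat2_norm (of_real t *\<^sub>C (1 :: 'a mat2)) \<le> \<bar>t\<bar>"
      using mat2_norm_scaleC_le[of "of_real t" "1 :: 'a mat2"]
        mult_left_mono[of "mat2_norm (1 :: 'a mat2)" 1 "\<bar>t\<bar>"] mat2_norm_one_le[where 'a = 'a]
      by simp
  qed simp
  finally have "(mat2_norm ?X)\<^sup>2 \<le> C\<^sup>2 + t\<^sup>2"
    by simp
  moreover have "(b + t)\<^sup>2 \<le> (mat2_norm ?X)\<^sup>2"
  proof -
    have "Im (\<Psi> ?X) = b + t"
      by (simp add: state_add[OF assms(1)] state_scaleC[OF assms(1)] state_one[OF assms(1)] b_def)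
    then have "\<bar>b + t\<bar> \<le> mat2_norm ?X"
      using abs_Im_le_cmod[of "\<Psi> ?X"] state_bound[OF assms(1), of ?X] by simp
    then show ?thesis
      by (metis power2_abs power_mono abs_ge_zero)
  qed
  moreover have "2 * b * t = C\<^sup>2 + 1"
    using \<open>b \<noteq> 0\<close> by (simp add: t_def)
  ultimately show False
    by (simp add: power2_sum) (smt (verit) zero_le_power2)
qed

lemma mat2_state_star:
  assumes "\<Psi> \<in> states mat2_norm"
  shows "\<Psi> (star A) = cnj (\<Psi> A)"
proof (rule complex_eqI)
  have "star (A + star A) = A + star A"
    by (simp add: star_add star_star)
  from mat2_state_selfadjoint_real[OF assms this] show "Im (\<Psi> (star A)) = Im (cnj (\<Psi> A))"
    by (simp add: state_add[OF assms])
  have "star (\<i> *\<^sub>C (A - star A)) = \<i> *\<^sub>C (A - star A)"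
    by (simp add: star_scaleC star_diff star_star scaleC.scale_right_diff_distrib scaleC.scale_minus_left)
  from mat2_state_selfadjoint_real[OF assms this] show "Re (\<Psi> (star A)) = Re (cnj (\<Psi> A))"
    by (simp add: state_scaleC[OF assms] state_diff[OF assms])
qed

lemma averaging_star: "star (averaging b) = averaging (star b)"
  by (simp add: averaging_def star_mat2_def star_scaleC)

lemma averaging_add: "averaging (b + c) = averaging b + averaging c"
  by (simp add: averaging_def plus_mat2_def scaleC_add_right)

lemma averaging_scaleC: "averaging (z *\<^sub>C b) = z *\<^sub>C averaging b"
  by (simp add: averaging_def scaleC_mat2_def scaleC_scaleC)

lemma averaging_mult: "averaging b * averaging c = averaging (b * c)"
  by (simp add: averaging_def times_mat2_def mult_scaleC_left mult_scaleC_right scaleC_scaleC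
      flip: scaleC_add_left)

lemma compress_averaging_one:
  "averaging 1 * A * averaging 1 = averaging ((1/2) *\<^sub>C (e11 A + e12 A + e21 A + e22 A))"
  by (simp add: averaging_def times_mat2_def mult_scaleC_left mult_scaleC_right scaleC_scaleC
      scaleC_add_right add_ac)

text \<open>
  A perturbation argument: for \<open>W = (1 - q)A\<close> the ranges of \<open>q\<close> and \<open>W\<close> are orthogonal, so the norm
  of \<open>q + cW\<close> exceeds \<open>1\<close> only to second order in \<open>c\<close>. A nonzero \<open>w = \<Psi>(W)\<close> would let
  \<open>\<Psi>(q + cW) = 1 + cw\<close> exceed it to first order.
\<close>

lemma mat2_state_kernel:
  assumes "\<Psi> \<in> states mat2_norm" and "\<Psi> (averaging 1) = 1"
  shows "\<Psi> ((1 - averaging 1) * A) = 0"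
proof (rule ccontr)
  let ?q = "averaging (1 :: 'a)"
  define W where "W = (1 - ?q) * A"
  define w where "w = \<Psi> W"
  define m where "m = mat2_norm W"
  assume "\<Psi> ((1 - averaging 1) * A) \<noteq> 0"
  then have "w \<noteq> 0"
    by (simp add: w_def W_def)
  define d where "d = 1 / (m\<^sup>2 + 1)"
  have "d > 0"
    by (simp add: d_def add_nonneg_pos)
  have "d * m\<^sup>2 < 1"
    by (simp add: d_def add_nonneg_pos)
  \<comment> \<open>The phase of \<open>c\<close> makes \<open>cw\<close> positive.\<close>
  define c where "c = of_real d * cnj w"
  let ?X = "?q + c *\<^sub>C W"
  have q: "?q * ?q = ?q" "star ?q = ?q"
    by (simp_all add: averaging_mult averaging_star)
  then have qW: "?q * W = 0"
    by (simp add: W_def algebra_simps flip: mult.assoc)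
  then have Wq: "star W * ?q = 0"
    using q(2) star_mult[of ?q W] by simp
  have "star ?X * ?X + star 0 * 0 = star ?q * ?q + star (c *\<^sub>C W) * (c *\<^sub>C W)"
    by (simp add: star_add q star_scaleC algebra_simps mult_scaleC_left mult_scaleC_right qW Wq)
  then have "(mat2_norm ?X)\<^sup>2 \<le> (mat2_norm ?q)\<^sup>2 + (mat2_norm (c *\<^sub>C W))\<^sup>2"
    by (rule mat2_norm_sq_le)
  also have "\<dots> \<le> 1\<^sup>2 + (cmod c * m)\<^sup>2"
    unfolding m_def using mat2_norm_averaging_le[of "1 :: 'a"]
    by (intro add_mono power_mono mat2_norm_scaleC_le) simp_all
  also have "\<dots> = 1 + d\<^sup>2 * (cmod w)\<^sup>2 * m\<^sup>2"
    using \<open>d > 0\<close> by (simp add: c_def norm_mult power_mult_distrib)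
  finally have "(mat2_norm ?X)\<^sup>2 \<le> 1 + d\<^sup>2 * (cmod w)\<^sup>2 * m\<^sup>2" .
  moreover have "(1 + d * (cmod w)\<^sup>2)\<^sup>2 \<le> (mat2_norm ?X)\<^sup>2"
  proof -
    have "\<Psi> ?X = 1 + c * w"
      by (simp add: state_add[OF assms(1)] state_scaleC[OF assms(1)] assms(2) w_def)
    also have "\<dots> = of_real (1 + d * (cmod w)\<^sup>2)"
      unfolding c_def of_real_add of_real_mult complex_norm_square by (simp add: mult_ac)
    finally have "cmod (\<Psi> ?X) = 1 + d * (cmod w)\<^sup>2"
      using \<open>d > 0\<close> by (simp only: norm_of_real) (simp add: add_nonneg_nonneg)
    then show ?thesis
      using state_bound[OF assms(1), of ?X] \<open>d > 0\<close> by (intro power_mono) simp_all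
  qed
  moreover have "(1 + d * (cmod w)\<^sup>2)\<^sup>2 \<ge> 1 + 2 * (d * (cmod w)\<^sup>2)"
    by (simp add: power2_sum)
  ultimately have "2 * (d * (cmod w)\<^sup>2) \<le> (d * (cmod w)\<^sup>2) * (d * m\<^sup>2)"
    by (simp add: power2_eq_square mult_ac)
  moreover have "d * (cmod w)\<^sup>2 > 0"
    using \<open>d > 0\<close> \<open>w \<noteq> 0\<close> by simp
  then have "(d * (cmod w)\<^sup>2) * (d * m\<^sup>2) < (d * (cmod w)\<^sup>2) * 1"
    using \<open>d * m\<^sup>2 < 1\<close> by (rule mult_strict_left_mono[rotated])
  ultimately show False
    using \<open>d * (cmod w)\<^sup>2 > 0\<close> by linarith
qed

text \<open>
  Such a state vanishes on \<open>(1 - q)A\<close> and, by taking adjoints, on \<open>A(1 - q)\<close>. It is therefore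
  determined by its values \<open>\<Psi>(qAq)\<close>, and \<open>qAq\<close> depends only on the sum of the entries of \<open>A\<close>.
\<close>

lemma mat2_state_eq_matrix_state:
  assumes "\<Psi> \<in> states mat2_norm" and "\<Psi> (averaging 1) = 1"
  obtains \<psi> where "\<psi> \<in> states norm" "\<Psi> = matrix_state \<psi>"
proof -
  define \<psi> where "\<psi> b = \<Psi> (averaging b)" for b
  let ?q = "averaging (1 :: 'a)"
  have \<psi>: "\<psi> \<in> states norm"
    unfolding states_iff \<psi>_def
    using assms(2) order_trans[OF state_bound[OF assms(1)] mat2_norm_averaging_le]
    by (simp add: averaging_add averaging_scaleC state_add[OF assms(1)] state_scaleC[OF assms(1)])
  have left: "\<Psi> (?q * A) = \<Psi> A" for A
    using mat2_state_kernel[OF assms, of A] by (simp add: left_diff_distrib state_diff[OF assms(1)])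
  have "star ?q = ?q"
    by (simp add: averaging_star)
  then have right: "\<Psi> (A * ?q) = \<Psi> A" for A
    using left[of "star A"] mat2_state_star[OF assms(1), of A]
      mat2_state_star[OF assms(1), of "A * ?q"] by (simp add: star_mult)
  have "\<Psi> A = \<Psi> (?q * A * ?q)" for A
    by (simp add: left right)
  then have "\<Psi> A = \<psi> ((1/2) *\<^sub>C (e11 A + e12 A + e21 A + e22 A))" for A
    by (simp only: compress_averaging_one \<psi>_def)
  then have "\<Psi> A = (1/2) * (\<psi> (e11 A) + \<psi> (e12 A) + \<psi> (e21 A) + \<psi> (e22 A))" for A
    by (simp only: state_scaleC[OF \<psi>] state_add[OF \<psi>])
  then have "\<Psi> = matrix_state \<psi>"
    by (intro ext) (simp add: matrix_state_def)
  with \<psi> show ?thesis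
    by (rule that)
qed

lemma matrix_state_averaging:
  "\<psi> \<in> states nrm \<Longrightarrow> matrix_state \<psi> (averaging b) = \<psi> b"
  by (simp add: matrix_state_def averaging_def state_scaleC)

lemma matrix_state_in_states:
  assumes "\<psi> \<in> states norm"
  shows "matrix_state \<psi> \<in> states mat2_norm"
proof -
  have "cmod (matrix_state \<psi> A) \<le> mat2_norm A" for A
  proof -
    have "matrix_state \<psi> A = \<psi> (e11 A + e12 A + e21 A + e22 A) / 2"
      by (simp add: matrix_state_def state_add[OF assms])
    then have "cmod (matrix_state \<psi> A) = cmod (\<psi> (e11 A + e12 A + e21 A + e22 A)) / 2"
      by (simp only: norm_divide norm_numeral)
    then have "cmod (matrix_state \<psi> A) \<le> norm (e11 A + e12 A + e21 A + e22 A) / 2"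
      using state_bound[OF assms, of "e11 A + e12 A + e21 A + e22 A"] by linarith
    then show ?thesis
      using norm_sum_entries_le[of A] by linarith
  qed
  then show ?thesis
    by (simp add: states_iff matrix_state_def mat2_ops state_add[OF assms] state_scaleC[OF assms]
        state_one[OF assms] state_zero[OF assms] add_divide_distrib distrib_left)
qed

text \<open>
  If \<open>\<Phi>\<^sub>\<omega>\<close> is a proper convex combination of two states, then both have value \<open>1\<close> at \<open>q\<close>, since
  \<open>\<Phi>\<^sub>\<omega>\<close> has that value and it is the largest possible one. Hence both come from states on \<open>B\<close>, and
  purity of \<open>\<omega>\<close> applies to those.
\<close>

lemma pure_matrix_state:
  assumes "pure_state norm \<omega>"
  shows "pure_state mat2_norm (matrix_state \<omega>)"
  unfolding pure_state_def
proof (intro conjI ballI allI impI, goal_cases)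
  case 1
  then show ?case
    using assms by (simp add: pure_state_def matrix_state_in_states)
next
  have main: "\<Phi> = matrix_state \<omega> \<and> \<Psi> = matrix_state \<omega>"
    if states: "\<Phi> \<in> states mat2_norm" "\<Psi> \<in> states mat2_norm"
      and t: "0 < t \<and> t < 1 \<and> (\<forall>x. matrix_state \<omega> x = of_real t * \<Phi> x + of_real (1 - t) * \<Psi> x)"
    for \<Phi> \<Psi> and t :: real
  proof -
    let ?q = "averaging (1 :: 'a)"
    have \<omega>: "\<omega> \<in> states norm"
      using assms by (simp add: pure_state_def)
    have bound: "cmod (\<Xi> ?q) \<le> 1" if "\<Xi> \<in> states mat2_norm" for \<Xi>
      using state_bound[OF that, of ?q] mat2_norm_averaging_le[of "1 :: 'a"] by simp
    have "of_real t * \<Phi> ?q + of_real (1 - t) * \<Psi> ?q = 1"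
      using t matrix_state_averaging[OF \<omega>, of 1] state_one[OF \<omega>] by metis
    from arg_cong[OF this, of Re] have "t * Re (\<Phi> ?q) + (1 - t) * Re (\<Psi> ?q) = 1"
      by simp
    moreover have Re_le: "Re (\<Phi> ?q) \<le> 1" "Re (\<Psi> ?q) \<le> 1"
      using bound[OF states(1)] bound[OF states(2)] complex_Re_le_cmod order_trans by blast+
    moreover have "t * Re (\<Phi> ?q) \<le> t" "(1 - t) * Re (\<Psi> ?q) \<le> 1 - t"
      using Re_le t by (simp_all add: mult_left_le)
    ultimately have "t * Re (\<Phi> ?q) = t" "(1 - t) * Re (\<Psi> ?q) = 1 - t"
      by linarith+
    then have "Re (\<Phi> ?q) = 1" "Re (\<Psi> ?q) = 1"
      using t by auto
    moreover have "z = 1" if "Re z = 1" "cmod z \<le> 1" for z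
    proof -
      have "(Re z)\<^sup>2 + (Im z)\<^sup>2 \<le> 1"
        using that(2) by (simp add: cmod_def)
      then show ?thesis
        using that(1) by (simp add: complex_eq_iff)
    qed
    ultimately have one: "\<Phi> ?q = 1" "\<Psi> ?q = 1"
      using bound states by auto
    obtain \<phi> where \<phi>: "\<phi> \<in> states norm" "\<Phi> = matrix_state \<phi>"
      using mat2_state_eq_matrix_state[OF states(1) one(1)] .
    obtain \<psi> where \<psi>: "\<psi> \<in> states norm" "\<Psi> = matrix_state \<psi>"
      using mat2_state_eq_matrix_state[OF states(2) one(2)] .
    have "\<omega> b = of_real t * \<phi> b + of_real (1 - t) * \<psi> b" for b
      using t unfolding \<phi>(2) \<psi>(2)
      by (metis matrix_state_averaging[OF \<omega>] matrix_state_averaging[OF \<phi>(1)]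
          matrix_state_averaging[OF \<psi>(1)])
    then have "\<phi> = \<omega> \<and> \<psi> = \<omega>"
      using assms \<phi>(1) \<psi>(1) t unfolding pure_state_def by blast
    then show ?thesis
      using \<phi>(2) \<psi>(2) by simp
  qed
  {
    case (2 \<Phi> \<Psi> t)
    then show ?case using main by blast
  next
    case (3 \<Phi> \<Psi> t)
    then show ?case using main by blast
  }
qed

lemma unital_subspace_upper_algebra:
  assumes "unital_subspace M"
  shows "unital_subspace (upper_algebra M)"
proof -
  have M: "scaleC.subspace M" "1 \<in> M"
    using assms by (auto simp: unital_subspace_def)
  have "scaleC.subspace (upper_algebra M)"
    unfolding scaleC.subspace_def
  proof (intro conjI ballI allI)
    show "0 \<in> upper_algebra M"
      unfolding upper_algebra_def using scaleC.subspace_0[OF M(1)]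
      by (auto simp: zero_mat2_def intro!: exI[of _ 0])
    fix A
    assume "A \<in> upper_algebra M"
    then obtain c x where A: "A = Mat2 (c *\<^sub>C 1) x 0 (c *\<^sub>C 1)" "x \<in> M"
      by (auto simp: upper_algebra_def)
    show "z *\<^sub>C A \<in> upper_algebra M" for z
      unfolding upper_algebra_def using scaleC.subspace_scale[OF M(1) A(2)]
      by (auto simp: A(1) scaleC_mat2_def scaleC_scaleC)
    fix B
    assume "B \<in> upper_algebra M"
    then obtain d y where B: "B = Mat2 (d *\<^sub>C 1) y 0 (d *\<^sub>C 1)" "y \<in> M"
      by (auto simp: upper_algebra_def)
    show "A + B \<in> upper_algebra M"
      unfolding upper_algebra_def using scaleC.subspace_add[OF M(1) A(2) B(2)]
      by (auto simp: A(1) B(1) plus_mat2_def scaleC_add_left[symmetric])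
  qed
  moreover have "1 \<in> upper_algebra M"
    unfolding upper_algebra_def using scaleC.subspace_0[OF M(1)]
    by (auto simp: one_mat2_def scaleC_one intro!: exI[of _ 1])
  ultimately show ?thesis
    by (simp add: unital_subspace_def)
qed

lemma corner_in_upper_algebra: "x \<in> M \<Longrightarrow> Mat2 0 x 0 0 \<in> upper_algebra M"
  by (auto simp: upper_algebra_def intro!: exI[of _ 0])

lemma matrix_state_corner: "\<psi> \<in> states nrm \<Longrightarrow> matrix_state \<psi> (Mat2 0 x 0 0) = \<psi> x / 2"
  by (simp add: matrix_state_def state_zero)

text \<open>
  The matrix unit \<open>E\<close> in the upper right corner belongs to the upper triangular algebra because
  \<open>1 \<in> M\<close>. As \<open>2q = 1 + E + E*\<close>, the value \<open>1/2\<close> at \<open>E\<close> forces the value \<open>1\<close> at \<open>q\<close>.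
\<close>

lemma state_extensions_upper_algebra:
  assumes "unital_subspace M" and \<omega>: "\<omega> \<in> states norm"
  shows "state_extensions mat2_norm (upper_algebra M) (matrix_state \<omega>)
    = matrix_state ` state_extensions norm M \<omega>"
proof (intro equalityI subsetI)
  fix \<Psi>
  assume "\<Psi> \<in> state_extensions mat2_norm (upper_algebra M) (matrix_state \<omega>)"
  then have \<Psi>: "\<Psi> \<in> states mat2_norm"
    and ext: "\<And>A. A \<in> upper_algebra M \<Longrightarrow> \<Psi> A = matrix_state \<omega> A"
    by (auto simp: state_extensions_def)
  let ?E = "Mat2 0 1 0 0 :: 'a mat2"
  have E: "\<Psi> ?E = 1/2"
    using ext[OF corner_in_upper_algebra] assms(1)
    by (simp add: unital_subspace_def matrix_state_corner[OF \<omega>] state_one[OF \<omega>])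
  have "averaging 1 = (1/2) *\<^sub>C (1 + (?E + star ?E))"
    by (simp add: averaging_def mat2_ops)
  then have "\<Psi> (averaging 1) = 1"
    by (simp add: state_scaleC[OF \<Psi>] state_add[OF \<Psi>] state_one[OF \<Psi>] mat2_state_star[OF \<Psi>] E
        del: mult_eq_0_iff)
  then obtain \<psi> where \<psi>: "\<psi> \<in> states norm" "\<Psi> = matrix_state \<psi>"
    using mat2_state_eq_matrix_state[OF \<Psi>] by blast
  have "\<psi> x = \<omega> x" if "x \<in> M" for x
    using ext[OF corner_in_upper_algebra[OF that]]
    by (simp add: \<psi>(2) matrix_state_corner[OF \<psi>(1)] matrix_state_corner[OF \<omega>])
  then show "\<Psi> \<in> matrix_state ` state_extensions norm M \<omega>"
    using \<psi> by (auto simp: state_extensions_def)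
next
  fix \<Psi>
  assume "\<Psi> \<in> matrix_state ` state_extensions norm M \<omega>"
  then obtain \<psi> where \<psi>: "\<psi> \<in> states norm" "\<And>x. x \<in> M \<Longrightarrow> \<psi> x = \<omega> x" "\<Psi> = matrix_state \<psi>"
    by (auto simp: state_extensions_def)
  have "\<Psi> A = matrix_state \<omega> A" if "A \<in> upper_algebra M" for A
    using that \<psi>(2)
    by (auto simp: \<psi>(3) upper_algebra_def matrix_state_def state_scaleC[OF \<psi>(1)]
        state_scaleC[OF \<omega>] state_one[OF \<psi>(1)] state_one[OF \<omega>] state_zero[OF \<psi>(1)] state_zero[OF \<omega>])
  then show "\<Psi> \<in> state_extensions mat2_norm (upper_algebra M) (matrix_state \<omega>)"
    using matrix_state_in_states[OF \<psi>(1)] by (simp add: state_extensions_def \<psi>(3))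
qed

section \<open>Pinnacle sets\<close>

text \<open>
  The witness is \<open>x = 1 + da\<close>, where \<open>a\<close> cuts out a slice around \<open>\<theta>\<close>. The three constraints on \<open>d\<close>
  say that the second-order term \<open>d\<^sup>2 a*a\<close> does not spoil the sign of the first-order term, nor the
  bound \<open>1 + \<epsilon>\<close> on the norm.
\<close>

theorem pinnacle_set_pure_state:
  assumes "unital_subspace N" "pure_state mat2_norm \<theta>" "state_extensions mat2_norm N \<theta> = {\<theta>}"
    and "\<epsilon> > 0"
  shows "pinnacle_set mat2_norm N \<epsilon> \<theta>"
  unfolding pinnacle_set_def
proof (intro allI impI, elim conjE)
  fix K
  assume K: "compact K" "K \<subseteq> states mat2_norm - {\<theta>}"
  obtain a m where a: "a \<in> N" "m > 0" "Re (\<theta> a) \<ge> m" "\<And>\<psi>. \<psi> \<in> K \<Longrightarrow> Re (\<psi> a) \<le> - m"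
    using pure_state_slice[OF assms(1-3) K] by blast
  define C D where "C = mat2_norm a" and "D = mat2_norm (star a * a)"
  have "D \<ge> 0"
    by (simp add: D_def)
  define d where "d = min 1 (min (m / (D + 1)) (\<epsilon> / (1 + 2 * C\<^sup>2)))"
  have d: "0 < d" "d \<le> 1"
    using \<open>m > 0\<close> \<open>\<epsilon> > 0\<close> \<open>D \<ge> 0\<close> by (auto simp: d_def add_pos_nonneg)
  have dD: "d * D < 2 * m"
  proof -
    have "d * (D + 1) \<le> m / (D + 1) * (D + 1)"
      using \<open>D \<ge> 0\<close> by (intro mult_right_mono) (simp_all add: d_def)
    then have "d * (D + 1) \<le> m"
      using \<open>D \<ge> 0\<close> by simp
    then show ?thesis
      using d \<open>m > 0\<close> by (simp add: distrib_left)
  qed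
  have dC: "d * (1 + 2 * C\<^sup>2) \<le> \<epsilon>"
  proof -
    have "0 < 1 + 2 * C\<^sup>2"
      by (simp add: add_pos_nonneg)
    then have "d * (1 + 2 * C\<^sup>2) \<le> \<epsilon> / (1 + 2 * C\<^sup>2) * (1 + 2 * C\<^sup>2)"
      by (intro mult_right_mono) (simp_all add: d_def)
    then show ?thesis
      using \<open>0 < 1 + 2 * C\<^sup>2\<close> by simp
  qed
  let ?x = "1 + of_real d *\<^sub>C a"
  have "?x \<in> N"
    using assms(1) a(1) by (auto simp: unital_subspace_def intro!: scaleC.subspace_add scaleC.subspace_scale)
  moreover have "mat2_norm ?x \<le> 1 + \<epsilon>"
  proof (rule power2_le_imp_le)
    have "(mat2_norm ?x)\<^sup>2 \<le> (1 + d) + (d + d\<^sup>2) * C\<^sup>2"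
      unfolding C_def using d by (intro mat2_norm_one_add_sq_le) simp
    also have "\<dots> \<le> (1 + d) + (d + d) * C\<^sup>2"
      using d by (intro add_left_mono mult_right_mono) (simp_all add: power2_eq_square mult_left_le)
    also have "\<dots> = 1 + d * (1 + 2 * C\<^sup>2)"
      by (simp add: algebra_simps)
    also have "\<dots> \<le> 1 + \<epsilon>"
      using dC by simp
    also have "\<dots> \<le> (1 + \<epsilon>)\<^sup>2"
      using assms(4) by (intro self_le_power) simp_all
    finally show "(mat2_norm ?x)\<^sup>2 \<le> (1 + \<epsilon>)\<^sup>2" .
  qed (use assms(4) in simp)
  moreover have quadratic: "\<exists>r. \<bar>r\<bar> \<le> D \<and> \<phi> (star ?x * ?x) = of_real (1 + d * (2 * Re (\<phi> a) + d * r))"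
    if \<phi>: "\<phi> \<in> states mat2_norm" for \<phi>
  proof (intro exI conjI)
    have "star (star a * a) = star a * a"
      by (simp add: star_mult star_star)
    then have real: "\<phi> (star a * a) = of_real (Re (\<phi> (star a * a)))"
      using mat2_state_selfadjoint_real[OF \<phi>] by (simp add: complex_eq_iff)
    show "\<bar>Re (\<phi> (star a * a))\<bar> \<le> D"
      unfolding D_def by (rule order_trans[OF abs_Re_le_cmod state_bound[OF \<phi>]])
    have "star ?x * ?x = 1 + of_real d *\<^sub>C ((a + star a) + of_real d *\<^sub>C (star a * a))"
      by (simp add: star_add star_scaleC algebra_simps mult_scaleC_left mult_scaleC_right
          scaleC_scaleC scaleC_add_right)
    then have "\<phi> (star ?x * ?x) = 1 + of_real d * ((\<phi> a + cnj (\<phi> a)) + of_real d * \<phi> (star a * a))"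
      by (simp only: state_add[OF \<phi>] state_scaleC[OF \<phi>] state_one[OF \<phi>] mat2_state_star[OF \<phi>])
    also have "\<dots> = of_real (1 + d * (2 * Re (\<phi> a) + d * Re (\<phi> (star a * a))))"
      by (subst real) (simp add: complex_add_cnj)
    finally show "\<phi> (star ?x * ?x)
        = of_real (1 + d * (2 * Re (\<phi> a) + d * Re (\<phi> (star a * a))))" .
  qed
  have small: "\<bar>d * r\<bar> < 2 * m" if "\<bar>r\<bar> \<le> D" for r
  proof -
    have "d * \<bar>r\<bar> \<le> d * D"
      using that d by (intro mult_left_mono) simp_all
    moreover have "\<bar>d * r\<bar> = d * \<bar>r\<bar>"
      using d by (simp add: abs_mult)
    ultimately show ?thesis
      using dD by linarith
  qed
  have "\<theta> (star ?x * ?x) > 1"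
  proof -
    obtain r where r: "\<bar>r\<bar> \<le> D" "\<theta> (star ?x * ?x) = of_real (1 + d * (2 * Re (\<theta> a) + d * r))"
      using quadratic[of \<theta>] assms(2) by (auto simp: pure_state_def)
    have "2 * Re (\<theta> a) + d * r > 0"
      using small[OF r(1)] a(3) by linarith
    then show ?thesis
      using d by (simp add: r(2) less_complex_def)
  qed
  moreover have "\<psi> (star ?x * ?x) < 1" if "\<psi> \<in> K" for \<psi>
  proof -
    have "\<psi> \<in> states mat2_norm"
      using that K(2) by blast
    obtain r where r: "\<bar>r\<bar> \<le> D" "\<psi> (star ?x * ?x) = of_real (1 + d * (2 * Re (\<psi> a) + d * r))"
      using quadratic[OF \<open>\<psi> \<in> states mat2_norm\<close>] by blast
    have "2 * Re (\<psi> a) + d * r < 0"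
      using small[OF r(1)] a(4)[OF that] by linarith
    then show ?thesis
      using d by (simp add: r(2) less_complex_def mult_pos_neg)
  qed
  ultimately show "\<exists>x\<in>N. mat2_norm x \<le> 1 + \<epsilon> \<and>
      (\<forall>\<Omega>\<in>state_extensions mat2_norm N \<theta>. \<Omega> (star x * x) > 1) \<and> (\<forall>\<psi>\<in>K. 1 > \<psi> (star x * x))"
    unfolding assms(3) by blast
qed

lemma pinnacle_set_imp_unique:
  assumes "pinnacle_set nrm N \<epsilon> \<theta>" "\<Psi> \<in> state_extensions nrm N \<theta>"
  shows "\<Psi> = \<theta>"
proof (rule ccontr)
  assume "\<Psi> \<noteq> \<theta>"
  then have "compact {\<Psi>} \<and> {\<Psi>} \<subseteq> states nrm - {\<theta>}"
    using assms(2) by (auto simp: state_extensions_def)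
  then obtain x where "\<Psi> (star x * x) > 1" "1 > \<Psi> (star x * x)"
    using assms unfolding pinnacle_set_def by blast
  then show False
    using less_asym by blast
qed

theorem corollary7p7:
  fixes M :: "'b::cstar_algebra_1 set" and \<omega> :: "'b \<Rightarrow> complex"
  assumes "unital_subspace M" and "closed M" and "pure_state norm \<omega>"
  shows "((\<exists>!\<psi>. \<psi> \<in> state_extensions norm M \<omega>) \<longleftrightarrow>
            (\<forall>\<epsilon>>0. pinnacle_set mat2_norm (upper_algebra M) \<epsilon> (matrix_state \<omega>)))
       \<and> ((\<forall>\<epsilon>>0. pinnacle_set mat2_norm (upper_algebra M) \<epsilon> (matrix_state \<omega>)) \<longleftrightarrow>
            (\<exists>\<epsilon>>0. pinnacle_set mat2_norm (upper_algebra M) \<epsilon> (matrix_state \<omega>)))"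
proof -
  let ?P = "\<lambda>\<epsilon>. pinnacle_set mat2_norm (upper_algebra M) \<epsilon> (matrix_state \<omega>)"
  have \<omega>: "\<omega> \<in> states norm"
    using assms(3) by (simp add: pure_state_def)
  have ext: "state_extensions mat2_norm (upper_algebra M) (matrix_state \<omega>)
      = matrix_state ` state_extensions norm M \<omega>"
    by (rule state_extensions_upper_algebra[OF assms(1) \<omega>])
  have self: "\<omega> \<in> state_extensions norm M \<omega>"
    using \<omega> by (simp add: state_extensions_def)
  have "\<forall>\<epsilon>>0. ?P \<epsilon>" if "\<exists>!\<psi>. \<psi> \<in> state_extensions norm M \<omega>"
  proof -
    have "state_extensions norm M \<omega> = {\<omega>}"
      using that self by auto
    then show ?thesis
      using pinnacle_set_pure_state[OF unital_subspace_upper_algebra[OF assms(1)]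
          pure_matrix_state[OF assms(3)]] ext by simp
  qed
  moreover have "\<exists>\<epsilon>>0. ?P \<epsilon>" if "\<forall>\<epsilon>>0. ?P \<epsilon>"
    using that zero_less_one by blast
  moreover have "\<exists>!\<psi>. \<psi> \<in> state_extensions norm M \<omega>" if "\<exists>\<epsilon>>0. ?P \<epsilon>"
  proof (rule ex1I)
    show "\<omega> \<in> state_extensions norm M \<omega>"
      by (rule self)
    fix \<psi>
    assume \<psi>: "\<psi> \<in> state_extensions norm M \<omega>"
    then have "matrix_state \<psi> = matrix_state \<omega>"
      using that ext pinnacle_set_imp_unique by blast
    moreover have "\<psi> \<in> states norm"
      using \<psi> by (simp add: state_extensions_def)
    ultimately have "\<psi> b = \<omega> b" for b
      using matrix_state_averaging[OF \<omega>, of b] matrix_state_averaging[of \<psi> norm b] by simp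
    then show "\<psi> = \<omega>"
      by blast
  qed
  ultimately show ?thesis
    by blast
qed

end
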